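(* Let $T>0$ be fixed. Consider the Ornstein-Uhlenbeck type process $(Z_t)_{t\geq 0}$ given by the SDE $\mathrm{d}Z_t=q(t)Z_t\,\mathrm{d}t+\sigma(t)\,\mathrm{d}B_t$, $t\ge0$, with continuous functions $q:[0,\infty)\to\mathbb{R}$ and $\sigma:[0,\infty)\to\mathbb{R}$, and suppose that $q$ is continuously differentiable on $[0,T)$. Then the law of the Ornstein-Uhlenbeck type bridge from $0$ to $0$ over $[0,T]$ derived from $Z$ coincides with the law of the usual Wiener bridge from $0$ to $0$ over $[0,T]$ if and only if $$q(t)=\frac{1}{t+C},\qquad t\in[0,T),$$ with some $C\in(\mathbb{R}\setminus[-T,0])\cup\{+\infty\}$, and either $\sigma(t)=1$ for all $t\in[0,T)$ or $\sigma(t)=-1$ for all $t\in[0,T)$. Here, for $C=+\infty$, it is meant that $q(t)=0$ for all $t\in[0,T)$.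
   Context: Ornstein-Uhlenbeck type process: the strong solution $(Z_t)_{t\ge0}$ of $\mathrm{d}Z_t=q(t)Z_t\,\mathrm{d}t+\sigma(t)\,\mathrm{d}B_t$, $t\ge 0$, where $q:[0,\infty)\to\mathbb{R}$ and $\sigma:[0,\infty)\to\mathbb{R}$ are continuous functions with $\sigma(t)\neq0$ for all $t\ge0$, $(B_t)_{t\ge0}$ is a one-dimensional standard Wiener process, and the initial value $Z_0$ has a Gauss (Gaussian, possibly degenerate) distribution and is independent of $B$. Put $\bar q(t):=\int_0^t q(u)\,\mathrm{d}u$ and $\gamma(s,t):=\int_s^t e^{2(\bar q(t)-\bar q(u))}\sigma^2(u)\,\mathrm{d}u$ for $0\le s\le t$. The bridge of Ornstein-Uhlenbeck type from $0$ to $0$ over $[0,T]$ derived from $Z$ is the process $$U_t=\int_0^t\frac{\gamma(t,T)}{\gamma(s,T)}e^{\bar q(t)-\bar q(s)}\sigma(s)\,\mathrm{d}B_s,\quad t\in[0,T),\qquad U_T=0,$$ which is an almost surely continuous Gauss process on $[0,T]$, or more generally any almost surely continuous process on $[0,T]$ having the same finite-dimensional distributions. The usual Wiener bridge from $0$ to $0$ over $[0,T]$ is the almost surely continuous Gauss process $X_t=\int_0^t\frac{T-t}{T-s}\,\mathrm{d}B_s$ for $t\in[0,T)$, $X_T=0$ (or any almost surely continuous process with the same finite-dimensional distributions). Laws of such processes coincide if their finite-dimensional distributions coincide. *)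

theory Defs
  imports "HOL-Probability.Probability"
begin

definition wiener_process :: "'a measure \<Rightarrow> (real \<Rightarrow> 'a \<Rightarrow> real) \<Rightarrow> bool" where
  "wiener_process M B \<longleftrightarrow>
     prob_space M \<and>
     (\<forall>t\<ge>0. B t \<in> borel_measurable M) \<and>
     (AE \<omega> in M. B 0 \<omega> = 0) \<and>
     (\<forall>(p :: nat \<Rightarrow> real) n. 0 \<le> p 0 \<and> (\<forall>i<n. p i \<le> p (Suc i)) \<longrightarrow>
        prob_space.indep_vars M (\<lambda>_. borel) (\<lambda>i \<omega>. B (p (Suc i)) \<omega> - B (p i) \<omega>) {..<n}) \<and>
     (\<forall>s t. 0 \<le> s \<and> s < t \<longrightarrow>
        distributed M lborel (\<lambda>\<omega>. B t \<omega> - B s \<omega>)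
          (\<lambda>x. ennreal (normal_density 0 (sqrt (t - s)) x))) \<and>
     (AE \<omega> in M. continuous_on {0..} (\<lambda>t. B t \<omega>))"

definition step_fun :: "nat \<Rightarrow> (nat \<Rightarrow> real) \<Rightarrow> (nat \<Rightarrow> real) \<Rightarrow> real \<Rightarrow> real" where
  "step_fun n p c x = (\<Sum>i<n. c i * indicator {p i<..p (Suc i)} x)"

definition step_wiener_integral ::
    "(real \<Rightarrow> 'a \<Rightarrow> real) \<Rightarrow> nat \<Rightarrow> (nat \<Rightarrow> real) \<Rightarrow> (nat \<Rightarrow> real) \<Rightarrow> 'a \<Rightarrow> real" where
  "step_wiener_integral B n p c \<omega> = (\<Sum>i<n. c i * (B (p (Suc i)) \<omega> - B (p i) \<omega>))"

text \<open>The Wiener integral of a deterministic square-integrable integrand \<open>f\<close> over \<open>[a, b]\<close> is the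
  \<open>L\<^sup>2(M)\<close>-limit of the elementary integrals of step functions converging to \<open>f\<close> in \<open>L\<^sup>2([a, b])\<close>.
  It is determined only up to almost sure equality, hence a relation.\<close>

definition has_wiener_integral ::
    "'a measure \<Rightarrow> (real \<Rightarrow> 'a \<Rightarrow> real) \<Rightarrow> (real \<Rightarrow> real) \<Rightarrow> real \<Rightarrow> real \<Rightarrow> ('a \<Rightarrow> real) \<Rightarrow> bool" where
  "has_wiener_integral M B f a b I \<longleftrightarrow>
     set_borel_measurable lborel {a..b} f \<and>
     I \<in> borel_measurable M \<and>
     (\<exists>(n :: nat \<Rightarrow> nat) (p :: nat \<Rightarrow> nat \<Rightarrow> real) (c :: nat \<Rightarrow> nat \<Rightarrow> real).
        (\<forall>k. p k 0 = a \<and> p k (n k) = b \<and> (\<forall>i<n k. p k i \<le> p k (Suc i))) \<and>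
        (\<lambda>k. \<integral>\<^sup>+x\<in>{a..b}. ennreal ((f x - step_fun (n k) (p k) (c k) x)\<^sup>2) \<partial>lborel) \<longlonglongrightarrow> 0 \<and>
        (\<lambda>k. \<integral>\<^sup>+\<omega>. ennreal ((I \<omega> - step_wiener_integral B (n k) (p k) (c k) \<omega>)\<^sup>2) \<partial>M) \<longlonglongrightarrow> 0)"

definition gaussian_rv :: "'a measure \<Rightarrow> ('a \<Rightarrow> real) \<Rightarrow> bool" where
  "gaussian_rv M X \<longleftrightarrow>
     X \<in> borel_measurable M \<and>
     ((\<exists>\<mu>. AE \<omega> in M. X \<omega> = \<mu>) \<or>
      (\<exists>\<mu> s. 0 < s \<and> distributed M lborel X (\<lambda>x. ennreal (normal_density \<mu> s x))))"

text \<open>Strong solution of \<open>dZ\<^sub>t = q(t) Z\<^sub>t dt + \<sigma>(t) dB\<^sub>t\<close> with a Gaussian (possibly degenerate) initial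
  value independent of \<open>B\<close>. The existence of \<open>\<Phi>\<close> says that \<open>Z t\<close> is, up to a null set, measurable
  with respect to the \<open>\<sigma>\<close>-algebra generated by \<open>Z 0\<close> and \<open>B s\<close>, \<open>s \<le> t\<close>.\<close>

definition ou_type_process ::
    "'a measure \<Rightarrow> (real \<Rightarrow> 'a \<Rightarrow> real) \<Rightarrow> (real \<Rightarrow> real) \<Rightarrow> (real \<Rightarrow> real) \<Rightarrow> (real \<Rightarrow> 'a \<Rightarrow> real) \<Rightarrow> bool"
  where
  "ou_type_process M B q \<sigma> Z \<longleftrightarrow>
     wiener_process M B \<and>
     gaussian_rv M (Z 0) \<and>
     prob_space.indep_set M
       (sets (vimage_algebra (space M) (Z 0) borel))
       (sets (vimage_algebra (space M) (\<lambda>\<omega>. \<lambda>t\<in>{0..}. B t \<omega>) (PiM {0..} (\<lambda>_. borel)))) \<and>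
     (\<forall>t\<ge>0. Z t \<in> borel_measurable M) \<and>
     (\<forall>t\<ge>0. \<exists>\<Phi> \<in> borel_measurable (borel \<Otimes>\<^sub>M PiM {0..t} (\<lambda>_. borel)).
        AE \<omega> in M. Z t \<omega> = \<Phi> (Z 0 \<omega>, \<lambda>s\<in>{0..t}. B s \<omega>)) \<and>
     (AE \<omega> in M. continuous_on {0..} (\<lambda>t. Z t \<omega>)) \<and>
     (\<forall>t\<ge>0. \<exists>I. has_wiener_integral M B \<sigma> 0 t I \<and>
        (AE \<omega> in M. Z t \<omega> = Z 0 \<omega> + integral {0..t} (\<lambda>u. q u * Z u \<omega>) + I \<omega>))"

definition qbar :: "(real \<Rightarrow> real) \<Rightarrow> real \<Rightarrow> real" where
  "qbar q t = integral {0..t} q"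

definition ou_gamma :: "(real \<Rightarrow> real) \<Rightarrow> (real \<Rightarrow> real) \<Rightarrow> real \<Rightarrow> real \<Rightarrow> real" where
  "ou_gamma q \<sigma> s t = integral {s..t} (\<lambda>u. exp (2 * (qbar q t - qbar q u)) * (\<sigma> u)\<^sup>2)"

definition same_fdd ::
    "real \<Rightarrow> 'a measure \<Rightarrow> (real \<Rightarrow> 'a \<Rightarrow> real) \<Rightarrow> 'b measure \<Rightarrow> (real \<Rightarrow> 'b \<Rightarrow> real) \<Rightarrow> bool" where
  "same_fdd T M X N Y \<longleftrightarrow>
     (\<forall>J. finite J \<and> J \<subseteq> {0..T} \<longrightarrow>
        distr M (PiM J (\<lambda>_. borel)) (\<lambda>\<omega>. \<lambda>t\<in>J. X t \<omega>) =
        distr N (PiM J (\<lambda>_. borel)) (\<lambda>\<omega>. \<lambda>t\<in>J. Y t \<omega>))"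

definition process_law :: "real \<Rightarrow> 'a measure \<Rightarrow> (real \<Rightarrow> 'a \<Rightarrow> real) \<Rightarrow> (real \<Rightarrow> real) measure" where
  "process_law T M X = distr M (PiM {0..T} (\<lambda>_. borel)) (\<lambda>\<omega>. \<lambda>t\<in>{0..T}. X t \<omega>)"

definition ae_continuous_process :: "real \<Rightarrow> 'a measure \<Rightarrow> (real \<Rightarrow> 'a \<Rightarrow> real) \<Rightarrow> bool" where
  "ae_continuous_process T M X \<longleftrightarrow>
     prob_space M \<and>
     (\<forall>t\<in>{0..T}. X t \<in> borel_measurable M) \<and>
     (AE \<omega> in M. continuous_on {0..T} (\<lambda>t. X t \<omega>))"

text \<open>The almost surely continuous process with \<open>U\<^sub>t = \<integral>\<^sub>0\<^sup>t k(t,s) dB\<^sub>s\<close> for \<open>t \<in> [0, T)\<close> and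
  \<open>U\<^sub>T = 0\<close>.\<close>

definition integral_bridge ::
    "'a measure \<Rightarrow> (real \<Rightarrow> 'a \<Rightarrow> real) \<Rightarrow> (real \<Rightarrow> real \<Rightarrow> real) \<Rightarrow> real \<Rightarrow> (real \<Rightarrow> 'a \<Rightarrow> real) \<Rightarrow> bool"
  where
  "integral_bridge M B k T U \<longleftrightarrow>
     ae_continuous_process T M U \<and>
     (\<forall>t\<in>{0..<T}. has_wiener_integral M B (k t) 0 t (U t)) \<and>
     (\<forall>\<omega>\<in>space M. U T \<omega> = 0)"

text \<open>In the next two definitions \<open>B\<close> is the driving Wiener process on \<open>M\<close>, while \<open>V\<close> is an almost
  surely continuous process, on a possibly different probability space \<open>N\<close>, that has the
  finite-dimensional distributions of the integral process.\<close>

definition ou_bridge ::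
    "'a measure \<Rightarrow> (real \<Rightarrow> 'a \<Rightarrow> real) \<Rightarrow> (real \<Rightarrow> real) \<Rightarrow> (real \<Rightarrow> real) \<Rightarrow> real \<Rightarrow>
     'b measure \<Rightarrow> (real \<Rightarrow> 'b \<Rightarrow> real) \<Rightarrow> bool" where
  "ou_bridge M B q \<sigma> T N V \<longleftrightarrow>
     ae_continuous_process T N V \<and>
     (\<exists>U. integral_bridge M B
            (\<lambda>t s. ou_gamma q \<sigma> t T / ou_gamma q \<sigma> s T * exp (qbar q t - qbar q s) * \<sigma> s) T U \<and>
          same_fdd T N V M U)"

definition wiener_bridge ::
    "'a measure \<Rightarrow> (real \<Rightarrow> 'a \<Rightarrow> real) \<Rightarrow> real \<Rightarrow> 'b measure \<Rightarrow> (real \<Rightarrow> 'b \<Rightarrow> real) \<Rightarrow> bool" where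
  "wiener_bridge M B T N V \<longleftrightarrow>
     ae_continuous_process T N V \<and>
     (\<exists>U. integral_bridge M B (\<lambda>t s. (T - t) / (T - s)) T U \<and> same_fdd T N V M U)"

end

theory Submission
  imports Defs
begin

text \<open>
  Write \<open>E(t) = exp (\<integral>\<^sub>0\<^sup>t q)\<close> and \<open>G(t) = \<integral>\<^sub>t\<^sup>T \<sigma>\<^sup>2 / E\<^sup>2\<close>. The kernel of the bridge is
  \<open>G(t) E(t) \<sigma>(s) / (G(s) E(s))\<close>, so by the Wiener isometry its covariance for \<open>s \<le> t\<close> is
  \<open>G(t) E(t) \<cdot> E(s) (1 - G(s) / G(0))\<close>, while that of the Wiener bridge is \<open>(T - t) s / T\<close>.
  If the laws agree, so do the covariances, and separating the variables gives \<open>G(t) E(t) = c (T - t)\<close>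
  and \<open>E(s) (1 - G(s) / G(0)) = s / (c T)\<close>. Hence \<open>E(t) = 1 + \<kappa> t\<close>, which determines \<open>q\<close>, and
  differentiating \<open>G(t) = c (T - t) / (1 + \<kappa> t)\<close> gives \<open>\<sigma>\<^sup>2 = 1\<close>.
  Conversely, for these coefficients the kernel is exactly \<open>\<plusminus>(T - t) / (T - s)\<close>, so both bridges are
  mean square limits of the same step integrals of two Wiener processes.
\<close>

section \<open>Mean square convergence\<close>

text \<open>\<open>has_wiener_integral\<close> only asserts that some sequence of step functions
  works, and integrals at different times carry unrelated sequences and partitions. The isometry is
  therefore proved for pairs of step functions on arbitrary partitions; it yields the covariances
  and shows that every approximating sequence leads to the same integral. Equality of laws passes to
  the limit through Lipschitz approximations of indicators of boxes, because mean square convergence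
  controls expectations of Lipschitz functions, not probabilities directly.

  In the separation of variables the two factors a = G E and b = E (1 - G / G(0)) recombine to E = b
  + a / G(0). Both summands are affine, so E is affine, and E(0) = 1 fixes its constant term. The
  slope is \<kappa> = 1 / (T c) - 1 / T, so that 1 + \<kappa> T = 1 / c is positive. For C = 1 /
  \<kappa> this positivity is the exclusion of [-T, 0], and \<kappa> = 0 is the case C =
  +\<infinity>.\<close>

definition L2_tendsto :: "'a measure \<Rightarrow> (nat \<Rightarrow> 'a \<Rightarrow> real) \<Rightarrow> ('a \<Rightarrow> real) \<Rightarrow> bool" where
  "L2_tendsto M Xs X \<longleftrightarrow> (\<lambda>k. \<integral>\<^sup>+\<omega>. ennreal ((X \<omega> - Xs k \<omega>)\<^sup>2) \<partial>M) \<longlonglongrightarrow> 0"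

definition sq_integrable :: "'a measure \<Rightarrow> ('a \<Rightarrow> real) \<Rightarrow> bool" where
  "sq_integrable M X \<longleftrightarrow> X \<in> borel_measurable M \<and> integrable M (\<lambda>\<omega>. (X \<omega>)\<^sup>2)"

lemma sq_integrable_mult:
  assumes "sq_integrable M X" "sq_integrable M Y"
  shows "integrable M (\<lambda>\<omega>. X \<omega> * Y \<omega>)"
proof (rule Bochner_Integration.integrable_bound)
  show "integrable M (\<lambda>\<omega>. (X \<omega>)\<^sup>2 + (Y \<omega>)\<^sup>2)"
    using assms by (auto simp: sq_integrable_def)
  show "(\<lambda>\<omega>. X \<omega> * Y \<omega>) \<in> borel_measurable M"
    using assms by (auto simp: sq_integrable_def)
  have "\<bar>x * y\<bar> \<le> x\<^sup>2 + y\<^sup>2" for x y :: real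
    using sum_squares_bound[of "\<bar>x\<bar>" "\<bar>y\<bar>"] zero_le_mult_iff[of "\<bar>x\<bar>" "\<bar>y\<bar>"]
    unfolding abs_mult power2_abs by linarith
  then show "AE \<omega> in M. norm (X \<omega> * Y \<omega>) \<le> norm ((X \<omega>)\<^sup>2 + (Y \<omega>)\<^sup>2)"
    by auto
qed

lemma sq_integrable_add:
  assumes "sq_integrable M X" "sq_integrable M Y"
  shows "sq_integrable M (\<lambda>\<omega>. X \<omega> + Y \<omega>)"
  using assms sq_integrable_mult[OF assms]
  by (auto simp: sq_integrable_def power2_sum mult.assoc)

lemma sq_integrable_cmult:
  assumes "sq_integrable M X"
  shows "sq_integrable M (\<lambda>\<omega>. c * X \<omega>)"
  using assms by (auto simp: sq_integrable_def power_mult_distrib)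

lemma sq_integrable_diff:
  assumes "sq_integrable M X" "sq_integrable M Y"
  shows "sq_integrable M (\<lambda>\<omega>. X \<omega> - Y \<omega>)"
  using sq_integrable_add[OF assms(1) sq_integrable_cmult[OF assms(2), of "-1"]] by simp

lemma sq_integrable_sum:
  assumes "\<And>i. i \<in> I \<Longrightarrow> sq_integrable M (X i)"
  shows "sq_integrable M (\<lambda>\<omega>. \<Sum>i\<in>I. X i \<omega>)"
  using assms
proof (induction I rule: infinite_finite_induct)
  case (insert i I)
  then show ?case by (simp add: sq_integrable_add)
qed (auto simp: sq_integrable_def)

text \<open>Follows from the inequality for nonnegative integrals applied to |X| and |Y|; square
  integrability makes every integral finite, so all of them turn into real integrals.\<close>

lemma Cauchy_Schwarz_lebesgue_integral:
  assumes X: "sq_integrable M X" and Y: "sq_integrable M Y"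
  shows "\<bar>\<integral>\<omega>. X \<omega> * Y \<omega> \<partial>M\<bar> \<le> sqrt (\<integral>\<omega>. (X \<omega>)\<^sup>2 \<partial>M) * sqrt (\<integral>\<omega>. (Y \<omega>)\<^sup>2 \<partial>M)"
proof -
  have [measurable]: "X \<in> borel_measurable M" "Y \<in> borel_measurable M"
    using X Y by (auto simp: sq_integrable_def)
  have XY: "integrable M (\<lambda>\<omega>. \<bar>X \<omega> * Y \<omega>\<bar>)"
    using sq_integrable_mult[OF X Y] by auto
  have sq: "(\<integral>\<^sup>+\<omega>. ennreal ((Z \<omega>)\<^sup>2) \<partial>M) = ennreal (\<integral>\<omega>. (Z \<omega>)\<^sup>2 \<partial>M)" if "sq_integrable M Z" for Z
    using that by (auto simp: sq_integrable_def intro!: nn_integral_eq_integral)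
  have "(\<integral>\<^sup>+\<omega>. ennreal \<bar>X \<omega>\<bar> * ennreal \<bar>Y \<omega>\<bar> \<partial>M)\<^sup>2 \<le>
      (\<integral>\<^sup>+\<omega>. (ennreal \<bar>X \<omega>\<bar>)\<^sup>2 \<partial>M) * (\<integral>\<^sup>+\<omega>. (ennreal \<bar>Y \<omega>\<bar>)\<^sup>2 \<partial>M)"
    by (rule Cauchy_Schwarz_nn_integral) auto
  also have "(\<integral>\<^sup>+\<omega>. ennreal \<bar>X \<omega>\<bar> * ennreal \<bar>Y \<omega>\<bar> \<partial>M) = ennreal (\<integral>\<omega>. \<bar>X \<omega> * Y \<omega>\<bar> \<partial>M)"
    using XY by (subst nn_integral_eq_integral[symmetric]) (auto simp: ennreal_mult abs_mult)
  also have "(\<integral>\<^sup>+\<omega>. (ennreal \<bar>X \<omega>\<bar>)\<^sup>2 \<partial>M) * (\<integral>\<^sup>+\<omega>. (ennreal \<bar>Y \<omega>\<bar>)\<^sup>2 \<partial>M) =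
      ennreal ((\<integral>\<omega>. (X \<omega>)\<^sup>2 \<partial>M) * (\<integral>\<omega>. (Y \<omega>)\<^sup>2 \<partial>M))"
    using sq[OF X] sq[OF Y] by (simp add: ennreal_power ennreal_mult)
  finally have "(\<integral>\<omega>. \<bar>X \<omega> * Y \<omega>\<bar> \<partial>M)\<^sup>2 \<le> (\<integral>\<omega>. (X \<omega>)\<^sup>2 \<partial>M) * (\<integral>\<omega>. (Y \<omega>)\<^sup>2 \<partial>M)"
    by (simp add: ennreal_power)
  then have "(\<integral>\<omega>. \<bar>X \<omega> * Y \<omega>\<bar> \<partial>M) \<le> sqrt ((\<integral>\<omega>. (X \<omega>)\<^sup>2 \<partial>M) * (\<integral>\<omega>. (Y \<omega>)\<^sup>2 \<partial>M))"
    by (rule real_le_rsqrt)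
  then show ?thesis
    unfolding real_sqrt_mult by (rule order_trans[OF integral_abs_bound])
qed

text \<open>A single k with distance below 1 suffices, since \<open>X\<close> is the sum of
  \<open>X - Xs k\<close> and \<open>Xs k\<close>.\<close>

lemma L2_tendsto_sq_integrable:
  assumes X: "X \<in> borel_measurable M" and Xs: "\<And>k. sq_integrable M (Xs k)"
    and lim: "L2_tendsto M Xs X"
  shows "sq_integrable M X"
proof -
  have "\<forall>\<^sub>F k in sequentially. (\<integral>\<^sup>+\<omega>. ennreal ((X \<omega> - Xs k \<omega>)\<^sup>2) \<partial>M) < 1"
    using lim unfolding L2_tendsto_def by (rule order_tendstoD) simp
  then obtain k where k: "(\<integral>\<^sup>+\<omega>. ennreal ((X \<omega> - Xs k \<omega>)\<^sup>2) \<partial>M) < 1"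
    by (auto simp: eventually_sequentially)
  have "sq_integrable M (\<lambda>\<omega>. X \<omega> - Xs k \<omega>)"
    unfolding sq_integrable_def
  proof (intro conjI integrableI_bounded)
    have "(\<integral>\<^sup>+ \<omega>. ennreal (norm ((X \<omega> - Xs k \<omega>)\<^sup>2)) \<partial>M) < 1"
      using k by simp
    then show "(\<integral>\<^sup>+ \<omega>. ennreal (norm ((X \<omega> - Xs k \<omega>)\<^sup>2)) \<partial>M) < \<infinity>"
      by (rule less_trans) simp
  qed (use X Xs[of k] in \<open>auto simp: sq_integrable_def\<close>)
  from sq_integrable_add[OF this Xs[of k]] show ?thesis by simp
qed

text \<open>Links the nonnegative integral, which presupposes no integrability and in which the
  Wiener integral is defined, with real integrals, to which Cauchy-Schwarz and the limit laws
  apply.\<close>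

lemma L2_tendsto_iff_integral:
  assumes X: "sq_integrable M X" and Xs: "\<And>k. sq_integrable M (Xs k)"
  shows "L2_tendsto M Xs X \<longleftrightarrow> (\<lambda>k. \<integral>\<omega>. (X \<omega> - Xs k \<omega>)\<^sup>2 \<partial>M) \<longlonglongrightarrow> 0"
proof -
  have "(\<integral>\<^sup>+\<omega>. ennreal ((X \<omega> - Xs k \<omega>)\<^sup>2) \<partial>M) = ennreal (\<integral>\<omega>. (X \<omega> - Xs k \<omega>)\<^sup>2 \<partial>M)" for k
    using sq_integrable_diff[OF X Xs[of k]]
    by (auto simp: sq_integrable_def intro!: nn_integral_eq_integral)
  then show ?thesis
    unfolding L2_tendsto_def by (simp only: ennreal_0[symmetric]) (rule tendsto_ennreal_iff, auto)
qed

text \<open>Continuity of the inner product: with D = X - Xs and E = Y - Ys the error Xs Ys - X Y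
  equals D E - D Y - X E, and Cauchy-Schwarz bounds each term. It carries the isometry from step
  integrals to their limits.\<close>

lemma L2_tendsto_mult:
  assumes X: "sq_integrable M X" and Xs: "\<And>k. sq_integrable M (Xs k)" and limX: "L2_tendsto M Xs X"
    and Y: "sq_integrable M Y" and Ys: "\<And>k. sq_integrable M (Ys k)" and limY: "L2_tendsto M Ys Y"
  shows "(\<lambda>k. \<integral>\<omega>. Xs k \<omega> * Ys k \<omega> \<partial>M) \<longlonglongrightarrow> (\<integral>\<omega>. X \<omega> * Y \<omega> \<partial>M)"
proof -
  define a where "a k = (\<integral>\<omega>. (X \<omega> - Xs k \<omega>)\<^sup>2 \<partial>M)" for k
  define b where "b k = (\<integral>\<omega>. (Y \<omega> - Ys k \<omega>)\<^sup>2 \<partial>M)" for k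
  have a: "a \<longlonglongrightarrow> 0" and b: "b \<longlonglongrightarrow> 0"
    using limX limY L2_tendsto_iff_integral[OF X Xs] L2_tendsto_iff_integral[OF Y Ys]
    by (auto simp: a_def[abs_def] b_def[abs_def])
  let ?x = "\<integral>\<omega>. (X \<omega>)\<^sup>2 \<partial>M" and ?y = "\<integral>\<omega>. (Y \<omega>)\<^sup>2 \<partial>M"
  have "\<bar>(\<integral>\<omega>. Xs k \<omega> * Ys k \<omega> \<partial>M) - (\<integral>\<omega>. X \<omega> * Y \<omega> \<partial>M)\<bar> \<le>
      sqrt (a k) * sqrt (b k) + sqrt (a k) * sqrt ?y + sqrt ?x * sqrt (b k)" for k
  proof -
    let ?D = "\<lambda>\<omega>. X \<omega> - Xs k \<omega>" and ?E = "\<lambda>\<omega>. Y \<omega> - Ys k \<omega>"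
    have D: "sq_integrable M ?D" and E: "sq_integrable M ?E"
      using X Xs Y Ys by (auto intro: sq_integrable_diff)
    have "(\<integral>\<omega>. Xs k \<omega> * Ys k \<omega> \<partial>M) =
        (\<integral>\<omega>. X \<omega> * Y \<omega> + ?D \<omega> * ?E \<omega> - ?D \<omega> * Y \<omega> - X \<omega> * ?E \<omega> \<partial>M)"
      by (intro Bochner_Integration.integral_cong) (auto simp: algebra_simps)
    also have "\<dots> = (\<integral>\<omega>. X \<omega> * Y \<omega> \<partial>M) + (\<integral>\<omega>. ?D \<omega> * ?E \<omega> \<partial>M) - (\<integral>\<omega>. ?D \<omega> * Y \<omega> \<partial>M)
        - (\<integral>\<omega>. X \<omega> * ?E \<omega> \<partial>M)"
      using sq_integrable_mult[OF X Y] sq_integrable_mult[OF D E] sq_integrable_mult[OF D Y]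
        sq_integrable_mult[OF X E]
      by simp
    finally have "\<bar>(\<integral>\<omega>. Xs k \<omega> * Ys k \<omega> \<partial>M) - (\<integral>\<omega>. X \<omega> * Y \<omega> \<partial>M)\<bar> \<le>
        \<bar>\<integral>\<omega>. ?D \<omega> * ?E \<omega> \<partial>M\<bar> + \<bar>\<integral>\<omega>. ?D \<omega> * Y \<omega> \<partial>M\<bar> + \<bar>\<integral>\<omega>. X \<omega> * ?E \<omega> \<partial>M\<bar>"
      by linarith
    then show ?thesis
      using Cauchy_Schwarz_lebesgue_integral[OF D E] Cauchy_Schwarz_lebesgue_integral[OF D Y]
        Cauchy_Schwarz_lebesgue_integral[OF X E]
      unfolding a_def b_def by linarith
  qed
  then have "\<forall>k. norm ((\<integral>\<omega>. Xs k \<omega> * Ys k \<omega> \<partial>M) - (\<integral>\<omega>. X \<omega> * Y \<omega> \<partial>M)) \<le>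
      sqrt (a k) * sqrt (b k) + sqrt (a k) * sqrt ?y + sqrt ?x * sqrt (b k)"
    unfolding real_norm_def by blast
  moreover have "(\<lambda>k. sqrt (a k) * sqrt (b k) + sqrt (a k) * sqrt ?y + sqrt ?x * sqrt (b k)) \<longlonglongrightarrow> 0"
  proof -
    have "(\<lambda>k. sqrt (a k) * sqrt (b k) + sqrt (a k) * sqrt ?y + sqrt ?x * sqrt (b k))
      \<longlonglongrightarrow> sqrt 0 * sqrt 0 + sqrt 0 * sqrt ?y + sqrt ?x * sqrt 0"
      by (intro tendsto_intros a b)
    then show ?thesis by simp
  qed
  ultimately have "(\<lambda>k. (\<integral>\<omega>. Xs k \<omega> * Ys k \<omega> \<partial>M) - (\<integral>\<omega>. X \<omega> * Y \<omega> \<partial>M)) \<longlonglongrightarrow> 0"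
    by (rule Lim_null_comparison[OF always_eventually])
  then show ?thesis
    by (rule LIM_zero_cancel)
qed

text \<open>The triangle inequality in the squared form (x - z)^2 \<le> 2 (x - y)^2 + 2 (y - z)^2,
  which avoids roots of extended nonnegative numbers. It allows one approximating sequence to be
  exchanged for another.\<close>

lemma L2_tendsto_trans:
  assumes X: "X \<in> borel_measurable M"
    and Xs: "\<And>k. Xs k \<in> borel_measurable M" and Ys: "\<And>k. Ys k \<in> borel_measurable M"
    and lim: "L2_tendsto M Xs X"
    and close: "(\<lambda>k. \<integral>\<^sup>+\<omega>. ennreal ((Xs k \<omega> - Ys k \<omega>)\<^sup>2) \<partial>M) \<longlonglongrightarrow> 0"
  shows "L2_tendsto M Ys X"
  unfolding L2_tendsto_def
proof (rule tendsto_sandwich[OF _ _ tendsto_const])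
  have [measurable]: "X \<in> borel_measurable M" "\<And>k. Xs k \<in> borel_measurable M"
      "\<And>k. Ys k \<in> borel_measurable M"
    by fact+
  let ?u = "\<lambda>k. 2 * (\<integral>\<^sup>+\<omega>. ennreal ((X \<omega> - Xs k \<omega>)\<^sup>2) \<partial>M) +
      2 * (\<integral>\<^sup>+\<omega>. ennreal ((Xs k \<omega> - Ys k \<omega>)\<^sup>2) \<partial>M)"
  have "?u \<longlonglongrightarrow> 2 * 0 + 2 * 0"
    using lim close unfolding L2_tendsto_def
    by (intro tendsto_add ennreal_tendsto_cmult) auto
  then show "?u \<longlonglongrightarrow> 0" by simp
  have sq: "(x - z)\<^sup>2 \<le> 2 * (x - y)\<^sup>2 + 2 * (y - z)\<^sup>2" for x y z :: real
    using sum_squares_bound[of "x - y" "y - z"] by (simp add: power2_eq_square algebra_simps)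
  have "(\<integral>\<^sup>+\<omega>. ennreal ((X \<omega> - Ys k \<omega>)\<^sup>2) \<partial>M) \<le>
      (\<integral>\<^sup>+\<omega>. 2 * ennreal ((X \<omega> - Xs k \<omega>)\<^sup>2) + 2 * ennreal ((Xs k \<omega> - Ys k \<omega>)\<^sup>2) \<partial>M)" for k
  proof (intro nn_integral_mono)
    fix \<omega>
    have "ennreal ((X \<omega> - Ys k \<omega>)\<^sup>2) \<le> ennreal (2 * (X \<omega> - Xs k \<omega>)\<^sup>2 + 2 * (Xs k \<omega> - Ys k \<omega>)\<^sup>2)"
      by (intro ennreal_leI sq)
    also have "\<dots> = 2 * ennreal ((X \<omega> - Xs k \<omega>)\<^sup>2) + 2 * ennreal ((Xs k \<omega> - Ys k \<omega>)\<^sup>2)"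
      by (simp add: ennreal_plus ennreal_mult)
    finally show "ennreal ((X \<omega> - Ys k \<omega>)\<^sup>2) \<le> \<dots>" .
  qed
  then show "\<forall>\<^sub>F k in sequentially. (\<integral>\<^sup>+\<omega>. ennreal ((X \<omega> - Ys k \<omega>)\<^sup>2) \<partial>M) \<le> ?u k"
    by (intro always_eventually allI) (auto simp: nn_integral_add nn_integral_cmult)
qed auto

section \<open>Wiener integrals\<close>

definition partition_of :: "nat \<Rightarrow> (nat \<Rightarrow> real) \<Rightarrow> real \<Rightarrow> real \<Rightarrow> bool" where
  "partition_of n p a b \<longleftrightarrow> p 0 = a \<and> p n = b \<and> (\<forall>i<n. p i \<le> p (Suc i))"

lemma partition_of_mono:
  assumes "partition_of n p a b" "i \<le> j" "j \<le> n"
  shows "p i \<le> p j"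
  using assms(2,3)
proof (induction j rule: dec_induct)
  case (step m)
  with assms(1) have "p m \<le> p (Suc m)" by (auto simp: partition_of_def)
  with step show ?case by force
qed simp

lemma partition_of_bounds:
  assumes "partition_of n p a b" "i \<le> n"
  shows "a \<le> p i" "p i \<le> b"
  using partition_of_mono[OF assms(1), of 0 i] partition_of_mono[OF assms(1), of i n] assms
  by (auto simp: partition_of_def)

lemma partition_of_nonneg:
  assumes "partition_of n p a b" "0 \<le> a" "i < n"
  shows "0 \<le> p i" "p i \<le> p (Suc i)"
  using partition_of_bounds(1)[OF assms(1), of i] assms by (auto simp: partition_of_def)

lemma step_fun_eq_0:
  assumes "partition_of n p a b" "x \<notin> {a..b}"
  shows "step_fun n p c x = 0"
  unfolding step_fun_def
proof (intro sum.neutral ballI)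
  fix i assume "i \<in> {..<n}"
  then have "a \<le> p i" "p (Suc i) \<le> b"
    using partition_of_bounds[OF assms(1)] by auto
  with assms(2) show "c i * indicator {p i<..p (Suc i)} x = 0"
    by (auto simp: indicator_def)
qed

lemma sq_integrable_indicator_Ioc: "sq_integrable lborel (indicator {a<..b::real})"
proof -
  have "(\<lambda>x. (indicator {a<..b} x :: real)\<^sup>2) = indicator {a<..b}"
    by (auto simp: indicator_def fun_eq_iff)
  then show ?thesis by (cases "a \<le> b") (auto simp: sq_integrable_def)
qed

text \<open>The length of the overlap, written as the combination of minima that arises when the
  covariance of two Wiener increments is expanded.\<close>

lemma integral_indicator_Ioc_mult:
  fixes a b c d :: real
  assumes "a \<le> b" "c \<le> d"
  shows "(\<integral>x. indicator {a<..b} x * indicator {c<..d} x \<partial>lborel) =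
    min b d - min b c - min a d + min a c"
proof -
  have "(\<lambda>x. indicator {a<..b} x * indicator {c<..d} x :: real) = indicator {max a c<..min b d}"
    by (auto simp: indicator_def fun_eq_iff)
  then have "(\<integral>x. indicator {a<..b} x * indicator {c<..d} x \<partial>lborel) =
      measure lborel {max a c<..min b d}"
    by simp
  also have "\<dots> = max 0 (min b d - max a c)"
    by (cases "max a c \<le> min b d") auto
  finally show ?thesis
    using assms by (auto simp: min_def max_def)
qed

lemma sq_integrable_step_fun: "sq_integrable lborel (step_fun n p c)"
  unfolding step_fun_def[abs_def]
  by (intro sq_integrable_sum sq_integrable_cmult sq_integrable_indicator_Ioc)

lemma integral_double_sum:
  fixes f :: "'i \<Rightarrow> 'j \<Rightarrow> 'a \<Rightarrow> real"
  assumes "\<And>i j. i \<in> A \<Longrightarrow> j \<in> C \<Longrightarrow> integrable M (f i j)"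
  shows "(\<integral>x. (\<Sum>i\<in>A. \<Sum>j\<in>C. w i j * f i j x) \<partial>M) = (\<Sum>i\<in>A. \<Sum>j\<in>C. w i j * (\<integral>x. f i j x \<partial>M))"
  using assms by simp

section \<open>Second moments of the Wiener process and the isometry for elementary
  integrals\<close>

context
  fixes M :: "'a measure" and B :: "real \<Rightarrow> 'a \<Rightarrow> real"
  assumes W: "wiener_process M B"
begin

lemma wiener_measurable: "0 \<le> t \<Longrightarrow> B t \<in> borel_measurable M"
  using W by (auto simp: wiener_process_def)

lemma wiener_increment:
  assumes "0 \<le> s" "s \<le> t"
  shows "sq_integrable M (\<lambda>\<omega>. B t \<omega> - B s \<omega>)" "(\<integral>\<omega>. (B t \<omega> - B s \<omega>)\<^sup>2 \<partial>M) = t - s"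
proof -
  have "sq_integrable M (\<lambda>\<omega>. B t \<omega> - B s \<omega>) \<and> (\<integral>\<omega>. (B t \<omega> - B s \<omega>)\<^sup>2 \<partial>M) = t - s"
  \<comment> \<open>The definition supplies a normal density only for s < t, so the null increment
    is treated apart.\<close>
  proof (cases "s = t")
    case True
    then show ?thesis by (simp add: sq_integrable_def)
  next
    case False
    let ?\<sigma> = "sqrt (t - s)"
    from False assms have \<sigma>: "0 < ?\<sigma>" and "s < t" by auto
    have D: "distributed M lborel (\<lambda>\<omega>. B t \<omega> - B s \<omega>) (\<lambda>x. ennreal (normal_density 0 ?\<sigma> x))"
      using W assms(1) \<open>s < t\<close> by (auto simp: wiener_process_def)
    have "integrable lborel (\<lambda>x. normal_density 0 ?\<sigma> x * x\<^sup>2)"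
      using integrable_normal_moment[OF \<sigma>, of 0 2] by simp
    then have "integrable M (\<lambda>\<omega>. (B t \<omega> - B s \<omega>)\<^sup>2)"
      by (subst (asm) distributed_integrable[OF D]) auto
    moreover have "(\<integral>\<omega>. (B t \<omega> - B s \<omega>)\<^sup>2 \<partial>M) = (\<integral>x. normal_density 0 ?\<sigma> x * x\<^sup>2 \<partial>lborel)"
      by (rule distributed_integral[OF D, symmetric]) auto
    moreover have "\<dots> = t - s"
      using integral_normal_moment_even[OF \<sigma>, of 0 1] \<open>s < t\<close> by (simp add: fact_numeral numeral_2_eq_2)
    ultimately show ?thesis
      using assms wiener_measurable by (auto simp: sq_integrable_def)
  qed
  then show "sq_integrable M (\<lambda>\<omega>. B t \<omega> - B s \<omega>)" "(\<integral>\<omega>. (B t \<omega> - B s \<omega>)\<^sup>2 \<partial>M) = t - s"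
    by auto
qed

lemma wiener_sq_integrable:
  assumes "0 \<le> t"
  shows "sq_integrable M (B t)" "(\<integral>\<omega>. (B t \<omega>)\<^sup>2 \<partial>M) = t"
proof -
  have "AE \<omega> in M. (B t \<omega> - B 0 \<omega>)\<^sup>2 = (B t \<omega>)\<^sup>2"
    using W by (auto simp: wiener_process_def)
  moreover have [measurable]: "B t \<in> borel_measurable M" "B 0 \<in> borel_measurable M"
    using assms by (auto intro: wiener_measurable)
  ultimately have "integrable M (\<lambda>\<omega>. (B t \<omega> - B 0 \<omega>)\<^sup>2) \<longleftrightarrow> integrable M (\<lambda>\<omega>. (B t \<omega>)\<^sup>2)"
    and "(\<integral>\<omega>. (B t \<omega> - B 0 \<omega>)\<^sup>2 \<partial>M) = (\<integral>\<omega>. (B t \<omega>)\<^sup>2 \<partial>M)"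
    by (intro integrable_cong_AE integral_cong_AE; simp)+
  then show "sq_integrable M (B t)" "(\<integral>\<omega>. (B t \<omega>)\<^sup>2 \<partial>M) = t"
    using wiener_increment[of 0 t] assms by (auto simp: sq_integrable_def)
qed

text \<open>Polarization: the product is half of (B s)^2 + (B t)^2 - (B t - B s)^2, and all three
  second moments are known.\<close>

lemma wiener_covariance:
  assumes "0 \<le> s" "0 \<le> t"
  shows "(\<integral>\<omega>. B s \<omega> * B t \<omega> \<partial>M) = min s t"
  using assms
proof (induction s t rule: linorder_wlog)
  case (le s t)
  then have "(\<integral>\<omega>. B s \<omega> * B t \<omega> \<partial>M) =
      (\<integral>\<omega>. ((B s \<omega>)\<^sup>2 + (B t \<omega>)\<^sup>2 - (B t \<omega> - B s \<omega>)\<^sup>2) / 2 \<partial>M)"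
    by (intro Bochner_Integration.integral_cong) (auto simp: power2_eq_square field_simps)
  also have "\<dots> = (s + t - (t - s)) / 2"
    using wiener_sq_integrable[of s] wiener_sq_integrable[of t] wiener_increment[of s t] le
    by (simp add: sq_integrable_def)
  finally show ?case using le by simp
qed (simp add: mult.commute min.commute)

text \<open>The isometry for two indicators. The intervals may overlap in any way, since both sides
  reduce to the same four minima.\<close>

lemma wiener_increment_mult:
  assumes "0 \<le> a" "a \<le> b" "0 \<le> c" "c \<le> d"
  shows "(\<integral>\<omega>. (B b \<omega> - B a \<omega>) * (B d \<omega> - B c \<omega>) \<partial>M) =
    (\<integral>x. indicator {a<..b} x * indicator {c<..d} x \<partial>lborel)"
proof -
  have i: "integrable M (\<lambda>\<omega>. B s \<omega> * B t \<omega>)" if "0 \<le> s" "0 \<le> t" for s t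
    using that by (intro sq_integrable_mult wiener_sq_integrable)
  have "(\<integral>\<omega>. (B b \<omega> - B a \<omega>) * (B d \<omega> - B c \<omega>) \<partial>M) =
      (\<integral>\<omega>. B b \<omega> * B d \<omega> - B b \<omega> * B c \<omega> - B a \<omega> * B d \<omega> + B a \<omega> * B c \<omega> \<partial>M)"
    by (intro Bochner_Integration.integral_cong) (auto simp: algebra_simps)
  also have "\<dots> = min b d - min b c - min a d + min a c"
    using assms by (simp add: i wiener_covariance)
  finally show ?thesis
    using assms by (simp add: integral_indicator_Ioc_mult)
qed

lemma sq_integrable_step_wiener_integral:
  assumes "partition_of n p a b" "0 \<le> a"
  shows "sq_integrable M (step_wiener_integral B n p c)"
  unfolding step_wiener_integral_def[abs_def]
proof (intro sq_integrable_sum sq_integrable_cmult wiener_increment)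
  fix i assume "i \<in> {..<n}"
  then show "0 \<le> p i" "p i \<le> p (Suc i)"
    using partition_of_nonneg[OF assms] by auto
qed

text \<open>Both sides are bilinear, which reduces the claim to pairs of intervals. As these may
  overlap arbitrarily, two unrelated partitions can be treated without a common refinement.\<close>

lemma step_wiener_integral_isometry:
  assumes p: "partition_of n p a b" "0 \<le> a" and p': "partition_of n' p' a' b'" "0 \<le> a'"
  shows "(\<integral>\<omega>. step_wiener_integral B n p c \<omega> * step_wiener_integral B n' p' c' \<omega> \<partial>M) =
    (\<integral>x. step_fun n p c x * step_fun n' p' c' x \<partial>lborel)"
proof -
  have b: "0 \<le> p i" "p i \<le> p (Suc i)" if "i < n" for i
    using partition_of_nonneg[OF p that] by auto
  have b': "0 \<le> p' i" "p' i \<le> p' (Suc i)" if "i < n'" for i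
    using partition_of_nonneg[OF p' that] by auto
  have "(\<integral>\<omega>. step_wiener_integral B n p c \<omega> * step_wiener_integral B n' p' c' \<omega> \<partial>M) =
      (\<integral>\<omega>. (\<Sum>i<n. \<Sum>j<n'. (c i * c' j) *
        ((B (p (Suc i)) \<omega> - B (p i) \<omega>) * (B (p' (Suc j)) \<omega> - B (p' j) \<omega>))) \<partial>M)"
    by (simp add: step_wiener_integral_def sum_product algebra_simps)
  also have "\<dots> = (\<Sum>i<n. \<Sum>j<n'. (c i * c' j) *
      (\<integral>\<omega>. (B (p (Suc i)) \<omega> - B (p i) \<omega>) * (B (p' (Suc j)) \<omega> - B (p' j) \<omega>) \<partial>M))"
    using b b' by (intro integral_double_sum sq_integrable_mult wiener_increment) auto
  also have "\<dots> = (\<Sum>i<n. \<Sum>j<n'. (c i * c' j) *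
      (\<integral>x. indicator {p i<..p (Suc i)} x * indicator {p' j<..p' (Suc j)} x \<partial>lborel))"
    using b b' by (intro sum.cong refl arg_cong2[of _ _ _ _ "(*)"] wiener_increment_mult) auto
  also have "\<dots> = (\<integral>x. (\<Sum>i<n. \<Sum>j<n'. (c i * c' j) *
      (indicator {p i<..p (Suc i)} x * indicator {p' j<..p' (Suc j)} x)) \<partial>lborel)"
    by (intro integral_double_sum[symmetric] sq_integrable_mult sq_integrable_indicator_Ioc)
  also have "\<dots> = (\<integral>x. step_fun n p c x * step_fun n' p' c' x \<partial>lborel)"
    by (simp only: step_fun_def sum_product mult_ac)
  finally show ?thesis .
qed

text \<open>Expansion of the square turns this into three instances of the isometry. It measures the
  distance between elementary integrals taken from different approximating sequences.\<close>

lemma step_wiener_integral_diff_isometry: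
  assumes p: "partition_of n p a b" "0 \<le> a" and p': "partition_of n' p' a' b'" "0 \<le> a'"
  shows "(\<integral>\<omega>. (step_wiener_integral B n p c \<omega> - step_wiener_integral B n' p' c' \<omega>)\<^sup>2 \<partial>M) =
    (\<integral>x. (step_fun n p c x - step_fun n' p' c' x)\<^sup>2 \<partial>lborel)"
proof -
  have sq: "(\<integral>x. (f x - g x)\<^sup>2 \<partial>N) = (\<integral>x. f x * f x \<partial>N) - 2 * (\<integral>x. f x * g x \<partial>N) + (\<integral>x. g x * g x \<partial>N)"
    if "sq_integrable N f" "sq_integrable N g" for N :: "'x measure" and f g
  proof -
    have "(\<integral>x. (f x - g x)\<^sup>2 \<partial>N) = (\<integral>x. f x * f x - 2 * (f x * g x) + g x * g x \<partial>N)"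
      by (intro Bochner_Integration.integral_cong) (auto simp: power2_eq_square algebra_simps)
    then show ?thesis
      using that by (simp add: sq_integrable_mult)
  qed
  note S = sq_integrable_step_wiener_integral[OF p] sq_integrable_step_wiener_integral[OF p']
  show ?thesis
    by (simp add: sq[OF S] sq[OF sq_integrable_step_fun sq_integrable_step_fun]
        step_wiener_integral_isometry[OF p p'] step_wiener_integral_isometry[OF p p]
        step_wiener_integral_isometry[OF p' p'])
qed

text \<open>Names the data that \<open>has_wiener_integral\<close> hides behind existential
  quantifiers. The restriction to [0, t] becomes a factor of the integrand, so that both
  convergences are instances of \<open>L2_tendsto\<close>.\<close>

definition wiener_approximates ::
    "(real \<Rightarrow> real) \<Rightarrow> real \<Rightarrow> ('a \<Rightarrow> real) \<Rightarrow> (nat \<Rightarrow> nat) \<Rightarrow> (nat \<Rightarrow> nat \<Rightarrow> real) \<Rightarrow>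
     (nat \<Rightarrow> nat \<Rightarrow> real) \<Rightarrow> bool" where
  "wiener_approximates f t I n p c \<longleftrightarrow> (\<forall>k. partition_of (n k) (p k) 0 t) \<and>
    L2_tendsto lborel (\<lambda>k. step_fun (n k) (p k) (c k)) (\<lambda>x. indicator {0..t} x * f x) \<and>
    L2_tendsto M (\<lambda>k. step_wiener_integral B (n k) (p k) (c k)) I"

lemma has_wiener_integral_measurable:
  assumes "has_wiener_integral M B f 0 t I"
  shows "I \<in> borel_measurable M" "(\<lambda>x. indicator {0..t} x * f x) \<in> borel_measurable lborel"
  using assms by (auto simp: has_wiener_integral_def set_borel_measurable_def)

lemma has_wiener_integralE:
  assumes "has_wiener_integral M B f 0 t I"
  obtains n p c where "wiener_approximates f t I n p c"
proof -
  from assms obtain n p c where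
    p: "\<forall>k. p k 0 = 0 \<and> p k (n k) = t \<and> (\<forall>i<n k. p k i \<le> p k (Suc i))" and
    f: "(\<lambda>k. \<integral>\<^sup>+x\<in>{0..t}. ennreal ((f x - step_fun (n k) (p k) (c k) x)\<^sup>2) \<partial>lborel) \<longlonglongrightarrow> 0" and
    I: "(\<lambda>k. \<integral>\<^sup>+\<omega>. ennreal ((I \<omega> - step_wiener_integral B (n k) (p k) (c k) \<omega>)\<^sup>2) \<partial>M) \<longlonglongrightarrow> 0"
    unfolding has_wiener_integral_def by auto
  have p': "partition_of (n k) (p k) 0 t" for k
    using p by (auto simp: partition_of_def)
  \<comment> \<open>Outside [0, t] both the indicator and the step function vanish, the latter
    because its partition runs from 0 to t.\<close>
  have "(\<integral>\<^sup>+x\<in>{0..t}. ennreal ((f x - step_fun (n k) (p k) (c k) x)\<^sup>2) \<partial>lborel) =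
      (\<integral>\<^sup>+x. ennreal ((indicator {0..t} x * f x - step_fun (n k) (p k) (c k) x)\<^sup>2) \<partial>lborel)" for k
    by (intro nn_integral_cong) (auto simp: indicator_def step_fun_eq_0[OF p'])
  with f I p' have "wiener_approximates f t I n p c"
    by (auto simp: wiener_approximates_def L2_tendsto_def)
  then show ?thesis by (rule that)
qed

text \<open>Along the approximating sequences the isometry equates the two inner products, and each
  side converges by continuity of the inner product; limits are unique.\<close>

lemma has_wiener_integral_covariance:
  assumes I: "has_wiener_integral M B f 0 s I" and J: "has_wiener_integral M B g 0 t J"
  shows "(\<integral>\<omega>. I \<omega> * J \<omega> \<partial>M) =
    (\<integral>x. (indicator {0..s} x * f x) * (indicator {0..t} x * g x) \<partial>lborel)"
proof -
  obtain n p c where A: "wiener_approximates f s I n p c"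
    using I by (rule has_wiener_integralE)
  obtain n' p' c' where A': "wiener_approximates g t J n' p' c'"
    using J by (rule has_wiener_integralE)
  have p: "\<And>k. partition_of (n k) (p k) 0 s" "\<And>k. partition_of (n' k) (p' k) 0 t"
    using A A' by (auto simp: wiener_approximates_def)
  note S = sq_integrable_step_wiener_integral[OF p(1) order_refl]
    sq_integrable_step_wiener_integral[OF p(2) order_refl]
  note m = has_wiener_integral_measurable[OF I] has_wiener_integral_measurable[OF J]
  have lim: "L2_tendsto M (\<lambda>k. step_wiener_integral B (n k) (p k) (c k)) I"
      "L2_tendsto M (\<lambda>k. step_wiener_integral B (n' k) (p' k) (c' k)) J"
      "L2_tendsto lborel (\<lambda>k. step_fun (n k) (p k) (c k)) (\<lambda>x. indicator {0..s} x * f x)"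
      "L2_tendsto lborel (\<lambda>k. step_fun (n' k) (p' k) (c' k)) (\<lambda>x. indicator {0..t} x * g x)"
    using A A' by (auto simp: wiener_approximates_def)
  have "(\<lambda>k. \<integral>\<omega>. step_wiener_integral B (n k) (p k) (c k) \<omega> *
      step_wiener_integral B (n' k) (p' k) (c' k) \<omega> \<partial>M) \<longlonglongrightarrow> (\<integral>\<omega>. I \<omega> * J \<omega> \<partial>M)"
    by (rule L2_tendsto_mult[OF L2_tendsto_sq_integrable[OF m(1) S(1) lim(1)] S(1) lim(1)
          L2_tendsto_sq_integrable[OF m(3) S(2) lim(2)] S(2) lim(2)])
  moreover have "(\<lambda>k. \<integral>x. step_fun (n k) (p k) (c k) x * step_fun (n' k) (p' k) (c' k) x \<partial>lborel)
      \<longlonglongrightarrow> (\<integral>x. (indicator {0..s} x * f x) * (indicator {0..t} x * g x) \<partial>lborel)"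
    by (rule L2_tendsto_mult[OF
          L2_tendsto_sq_integrable[OF m(2) sq_integrable_step_fun lim(3)] sq_integrable_step_fun lim(3)
          L2_tendsto_sq_integrable[OF m(4) sq_integrable_step_fun lim(4)] sq_integrable_step_fun lim(4)])
  ultimately show ?thesis
    by (simp add: step_wiener_integral_isometry[OF p(1) order_refl p(2) order_refl] LIMSEQ_unique)
qed

text \<open>Upgrades "some approximating sequence" to "every approximating sequence". Two sequences
  of step functions converging to f approach each other, and by the isometry so do their elementary
  integrals.\<close>

lemma L2_tendsto_step_wiener_integral:
  assumes I: "has_wiener_integral M B f 0 t I"
    and p: "\<And>k. partition_of (n k) (p k) 0 t"
    and lim: "L2_tendsto lborel (\<lambda>k. step_fun (n k) (p k) (c k)) (\<lambda>x. indicator {0..t} x * f x)"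
  shows "L2_tendsto M (\<lambda>k. step_wiener_integral B (n k) (p k) (c k)) I"
proof -
  obtain n' p' c' where A: "wiener_approximates f t I n' p' c'"
    using I by (rule has_wiener_integralE)
  then have p': "\<And>k. partition_of (n' k) (p' k) 0 t"
    by (auto simp: wiener_approximates_def)
  let ?S = "\<lambda>k. step_wiener_integral B (n k) (p k) (c k)"
  let ?S' = "\<lambda>k. step_wiener_integral B (n' k) (p' k) (c' k)"
  let ?g = "\<lambda>k. step_fun (n k) (p k) (c k)" and ?g' = "\<lambda>k. step_fun (n' k) (p' k) (c' k)"
  have S: "sq_integrable M (?S k)" "sq_integrable M (?S' k)" for k
    by (rule sq_integrable_step_wiener_integral[OF p order_refl] sq_integrable_step_wiener_integral[OF p' order_refl])+
  show ?thesis
  proof (rule L2_tendsto_trans)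
    show "I \<in> borel_measurable M"
      using I by (rule has_wiener_integral_measurable)
    show "L2_tendsto M ?S' I"
      using A by (auto simp: wiener_approximates_def)
    have F: "sq_integrable lborel (\<lambda>x. indicator {0..t} x * f x)"
      using lim has_wiener_integral_measurable[OF I]
      by (intro L2_tendsto_sq_integrable[OF _ sq_integrable_step_fun])
    have gg: "(\<integral>x. (?g' k x - ?g k x)\<^sup>2 \<partial>lborel) \<le>
        2 * (\<integral>x. (indicator {0..t} x * f x - ?g' k x)\<^sup>2 \<partial>lborel) +
        2 * (\<integral>x. (indicator {0..t} x * f x - ?g k x)\<^sup>2 \<partial>lborel)" for k
    proof -
      have sq: "(x - y)\<^sup>2 \<le> 2 * (z - x)\<^sup>2 + 2 * (z - y)\<^sup>2" for x y z :: real
        using sum_squares_bound[of "x - z" "z - y"] by (simp add: power2_eq_square algebra_simps)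
      have i: "integrable lborel (\<lambda>x. (indicator {0..t} x * f x - ?g' k x)\<^sup>2)"
          "integrable lborel (\<lambda>x. (indicator {0..t} x * f x - ?g k x)\<^sup>2)"
          "integrable lborel (\<lambda>x. (?g' k x - ?g k x)\<^sup>2)"
        using sq_integrable_diff[OF F sq_integrable_step_fun] sq_integrable_diff[OF sq_integrable_step_fun sq_integrable_step_fun]
        unfolding sq_integrable_def by blast+
      have "(\<integral>x. (?g' k x - ?g k x)\<^sup>2 \<partial>lborel) \<le> (\<integral>x. 2 * (indicator {0..t} x * f x - ?g' k x)\<^sup>2 +
          2 * (indicator {0..t} x * f x - ?g k x)\<^sup>2 \<partial>lborel)"
        using i by (intro integral_mono sq) auto
      also have "\<dots> = 2 * (\<integral>x. (indicator {0..t} x * f x - ?g' k x)\<^sup>2 \<partial>lborel) +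
        2 * (\<integral>x. (indicator {0..t} x * f x - ?g k x)\<^sup>2 \<partial>lborel)"
        using i by simp
      finally show ?thesis .
    qed
    have g': "(\<lambda>k. \<integral>x. (indicator {0..t} x * f x - ?g' k x)\<^sup>2 \<partial>lborel) \<longlonglongrightarrow> 0"
      using A L2_tendsto_iff_integral[OF F sq_integrable_step_fun, of n' p' c'] by (simp add: wiener_approximates_def)
    have g: "(\<lambda>k. \<integral>x. (indicator {0..t} x * f x - ?g k x)\<^sup>2 \<partial>lborel) \<longlonglongrightarrow> 0"
      using lim L2_tendsto_iff_integral[OF F sq_integrable_step_fun, of n p c] by simp
    have "(\<lambda>k. 2 * (\<integral>x. (indicator {0..t} x * f x - ?g' k x)\<^sup>2 \<partial>lborel) +
        2 * (\<integral>x. (indicator {0..t} x * f x - ?g k x)\<^sup>2 \<partial>lborel)) \<longlonglongrightarrow> 2 * 0 + 2 * 0"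
      by (intro tendsto_intros g g')
    then have u: "(\<lambda>k. 2 * (\<integral>x. (indicator {0..t} x * f x - ?g' k x)\<^sup>2 \<partial>lborel) +
        2 * (\<integral>x. (indicator {0..t} x * f x - ?g k x)\<^sup>2 \<partial>lborel)) \<longlonglongrightarrow> 0"
      by simp
    have "(\<lambda>k. \<integral>x. (?g' k x - ?g k x)\<^sup>2 \<partial>lborel) \<longlonglongrightarrow> 0"
      by (rule real_tendsto_sandwich[OF _ _ tendsto_const u]) (use gg in auto)
    moreover have "(\<integral>\<^sup>+\<omega>. ennreal ((?S' k \<omega> - ?S k \<omega>)\<^sup>2) \<partial>M) =
        ennreal (\<integral>x. (?g' k x - ?g k x)\<^sup>2 \<partial>lborel)" for k
    proof -
      have "(\<integral>\<^sup>+\<omega>. ennreal ((?S' k \<omega> - ?S k \<omega>)\<^sup>2) \<partial>M) = ennreal (\<integral>\<omega>. (?S' k \<omega> - ?S k \<omega>)\<^sup>2 \<partial>M)"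
        using sq_integrable_diff[OF S(2)[of k] S(1)[of k]]
        by (intro nn_integral_eq_integral) (auto simp: sq_integrable_def)
      then show ?thesis
        by (simp add: step_wiener_integral_diff_isometry[OF p' order_refl p order_refl])
    qed
    ultimately show "(\<lambda>k. \<integral>\<^sup>+\<omega>. ennreal ((?S' k \<omega> - ?S k \<omega>)\<^sup>2) \<partial>M) \<longlonglongrightarrow> 0"
      using tendsto_ennrealI[of "\<lambda>k. \<integral>x. (?g' k x - ?g k x)\<^sup>2 \<partial>lborel" 0] by simp
  qed (use S in \<open>auto simp: sq_integrable_def\<close>)
qed

end

section \<open>Finite-dimensional distributions of the Wiener process\<close>

lemma wiener_increments_distr:
  fixes p :: "nat \<Rightarrow> real"
  assumes W: "wiener_process M B" and p0: "0 \<le> p 0" and p: "\<And>i. i < n \<Longrightarrow> p i < p (Suc i)"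
    and n: "0 < n"
  shows "distr M (PiM {..<n} (\<lambda>_. borel)) (\<lambda>\<omega>. \<lambda>i\<in>{..<n}. B (p (Suc i)) \<omega> - B (p i) \<omega>) =
    PiM {..<n} (\<lambda>i. density lborel (\<lambda>x. ennreal (normal_density 0 (sqrt (p (Suc i) - p i)) x)))"
proof -
  interpret prob_space M using W by (auto simp: wiener_process_def)
  have part: "partition_of n p (p 0) (p n)"
    using p by (auto simp: partition_of_def less_imp_le)
  have nonneg: "0 \<le> p i" if "i \<le> n" for i
    using partition_of_bounds(1)[OF part that] p0 by linarith
  have rv: "random_variable borel (\<lambda>\<omega>. B (p (Suc i)) \<omega> - B (p i) \<omega>)" if "i \<in> {..<n}" for i
    using nonneg[of i] nonneg[of "Suc i"] that wiener_measurable[OF W] by auto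
  have "indep_vars (\<lambda>_. borel) (\<lambda>i \<omega>. B (p (Suc i)) \<omega> - B (p i) \<omega>) {..<n}"
    using W p0 p by (auto simp: wiener_process_def less_imp_le)
  moreover have "{..<n} \<noteq> {}" using n by auto
  ultimately have "distr M (PiM {..<n} (\<lambda>_. borel)) (\<lambda>\<omega>. \<lambda>i\<in>{..<n}. B (p (Suc i)) \<omega> - B (p i) \<omega>) =
      PiM {..<n} (\<lambda>i. distr M borel (\<lambda>\<omega>. B (p (Suc i)) \<omega> - B (p i) \<omega>))"
    using rv by (subst (asm) indep_vars_iff_distr_eq_PiM') auto
  also have "\<dots> = PiM {..<n} (\<lambda>i. density lborel (\<lambda>x. ennreal (normal_density 0 (sqrt (p (Suc i) - p i)) x)))"
  proof (rule PiM_cong[OF refl])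
    fix i assume "i \<in> {..<n}"
    then have "distributed M lborel (\<lambda>\<omega>. B (p (Suc i)) \<omega> - B (p i) \<omega>)
        (\<lambda>x. ennreal (normal_density 0 (sqrt (p (Suc i) - p i)) x))"
      using W p nonneg by (auto simp: wiener_process_def)
    from distributed_distr_eq_density[OF this]
    show "distr M borel (\<lambda>\<omega>. B (p (Suc i)) \<omega> - B (p i) \<omega>) =
        density lborel (\<lambda>x. ennreal (normal_density 0 (sqrt (p (Suc i) - p i)) x))"
      \<comment> \<open>\<open>distributed\<close> refers to \<open>lborel\<close>, the product to
        \<open>borel\<close>; the image measure depends only on the \<sigma>-algebra of the target,
        which is the same.\<close>
      by (subst distr_cong[OF refl _ refl, of borel lborel]) auto
  qed
  finally show ?thesis .
qed

text \<open>Both vectors are images of one product of normal laws under one map, the partial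
  summation of increments over the sorted time points.\<close>

lemma wiener_fdd_eq:
  assumes W: "wiener_process M B" and W': "wiener_process M' B'" and P: "finite P" "P \<subseteq> {0..}"
  shows "distr M (PiM P (\<lambda>_. borel)) (\<lambda>\<omega>. \<lambda>t\<in>P. B t \<omega>) =
    distr M' (PiM P (\<lambda>_. borel)) (\<lambda>\<omega>. \<lambda>t\<in>P. B' t \<omega>)"
proof -
  \<comment> \<open>The point 1 guarantees at least one increment; the independence lemma needs a nonempty index set.\<close>
  define xs where "xs = sorted_list_of_set (insert 0 (insert 1 P))"
  define n where "n = length xs - 1"
  have set_xs: "set xs = insert 0 (insert 1 P)" and sorted: "sorted_wrt (<) xs"
    using P by (auto simp: xs_def simp del: sorted_list_of_set_insert_remove)
  have "card (set xs) = length xs"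
    using sorted by (intro distinct_card) (simp add: strict_sorted_iff)
  moreover have "card {0, 1::real} \<le> card (set xs)"
    using set_xs P by (intro card_mono) auto
  ultimately have len: "2 \<le> length xs" by simp
  have inc: "xs ! i < xs ! Suc i" if "i < n" for i
    using sorted that by (auto simp: n_def intro: sorted_wrt_nth_less)
  have "0 \<in> set xs" using set_xs by simp
  then obtain i where i: "i < length xs" "xs ! i = 0" by (auto simp: in_set_conv_nth)
  have "xs ! 0 \<in> set xs" using len by (intro nth_mem) linarith
  then have "0 \<le> xs ! 0" using set_xs P by auto
  moreover have "xs ! 0 \<le> xs ! i"
    using sorted_wrt_nth_less[OF sorted, of 0 i] i by (cases "i = 0") auto
  ultimately have zero: "xs ! 0 = 0" using i by simp
  have "\<exists>j\<le>n. xs ! j = t" if "t \<in> P" for t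
  proof -
    from that have "t \<in> set xs" using set_xs by simp
    then obtain j where "j < length xs" "xs ! j = t" by (auto simp: in_set_conv_nth)
    then show ?thesis by (intro exI[of _ j]) (auto simp: n_def)
  qed
  then obtain idx where idx: "\<And>t. t \<in> P \<Longrightarrow> idx t \<le> n" "\<And>t. t \<in> P \<Longrightarrow> xs ! idx t = t"
    by metis
  \<comment> \<open>\<open>idx t\<close> is the position of t in the sorted list. The list starts at
    0, where the process vanishes, so the value at t is the sum of the first \<open>idx t\<close>
    increments.\<close>
  let ?F = "\<lambda>y :: nat \<Rightarrow> real. \<lambda>t\<in>P. \<Sum>i<idx t. y i"
  let ?N = "PiM {..<n} (\<lambda>i. density lborel (\<lambda>x. ennreal (normal_density 0 (sqrt (xs ! Suc i - xs ! i)) x)))"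
  have F: "?F \<in> PiM {..<n} (\<lambda>_. borel) \<rightarrow>\<^sub>M PiM P (\<lambda>_. borel)"
    using idx(1) by (intro measurable_restrict borel_measurable_sum measurable_component_singleton) force
  \<comment> \<open>Stated for an arbitrary Wiener process on an arbitrary space, so that both
    processes are compared with the same right-hand side.\<close>
  have *: "distr N (PiM P (\<lambda>_. borel)) (\<lambda>\<omega>. \<lambda>t\<in>P. C t \<omega>) = distr ?N (PiM P (\<lambda>_. borel)) ?F"
    if C: "wiener_process N C" for N :: "'x measure" and C
  proof -
    let ?D = "\<lambda>\<omega>. \<lambda>i\<in>{..<n}. C (xs ! Suc i) \<omega> - C (xs ! i) \<omega>"
    have D: "?D \<in> N \<rightarrow>\<^sub>M PiM {..<n} (\<lambda>_. borel)"
    proof (intro measurable_restrict borel_measurable_diff wiener_measurable[OF C])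
      fix i assume "i \<in> {..<n}"
      then have "xs ! i \<in> set xs" "xs ! Suc i \<in> set xs"
        by (auto simp: n_def)
      then show "0 \<le> xs ! i" "0 \<le> xs ! Suc i"
        using set_xs P by auto
    qed
    have "distr N (PiM P (\<lambda>_. borel)) (\<lambda>\<omega>. \<lambda>t\<in>P. C t \<omega>) = distr N (PiM P (\<lambda>_. borel)) (?F \<circ> ?D)"
    \<comment> \<open>The process starts at 0 only almost surely, so the two vectors agree up to a
      null set.\<close>
    proof (rule distr_cong_AE[OF refl refl])
      have "AE \<omega> in N. C 0 \<omega> = 0" using C by (auto simp: wiener_process_def)
      then show "AE \<omega> in N. (\<lambda>t\<in>P. C t \<omega>) = (?F \<circ> ?D) \<omega>"
      proof eventually_elim
        case (elim \<omega>)
        have "C t \<omega> = (\<Sum>i<idx t. ?D \<omega> i)" if "t \<in> P" for t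
        proof -
          have "(\<Sum>i<idx t. ?D \<omega> i) = (\<Sum>i<idx t. C (xs ! Suc i) \<omega> - C (xs ! i) \<omega>)"
            using idx(1)[OF that] by (intro sum.cong) auto
          also have "\<dots> = C (xs ! idx t) \<omega> - C (xs ! 0) \<omega>"
            by (rule sum_lessThan_telescope)
          finally show ?thesis using zero elim idx(2)[OF that] by simp
        qed
        then show ?case by (auto simp: fun_eq_iff)
      qed
      show "(\<lambda>\<omega>. \<lambda>t\<in>P. C t \<omega>) \<in> N \<rightarrow>\<^sub>M PiM P (\<lambda>_. borel)"
        using P by (intro measurable_restrict wiener_measurable[OF C]) auto
      show "?F \<circ> ?D \<in> N \<rightarrow>\<^sub>M PiM P (\<lambda>_. borel)"
        using D F by (rule measurable_comp)
    qed
    also have "\<dots> = distr (distr N (PiM {..<n} (\<lambda>_. borel)) ?D) (PiM P (\<lambda>_. borel)) ?F"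
      by (rule distr_distr[OF F D, symmetric])
    also have "distr N (PiM {..<n} (\<lambda>_. borel)) ?D = ?N"
      using inc len by (intro wiener_increments_distr[OF C]) (auto simp: zero n_def)
    finally show ?thesis .
  qed
  show ?thesis using *[OF W] *[OF W'] by simp
qed

section \<open>Laws of mean square limits\<close>

text \<open>A Lipschitz approximation of the indicator of \<open>{..a}\<close> from above, as \<open>m \<rightarrow> \<infinity>\<close>.\<close>

definition ramp :: "nat \<Rightarrow> real \<Rightarrow> real \<Rightarrow> real" where
  "ramp m a x = max 0 (min 1 (1 - real m * (x - a)))"

lemma ramp_bounds: "0 \<le> ramp m a x" "ramp m a x \<le> 1"
  by (auto simp: ramp_def)

text \<open>Truncation to [0, 1] does not increase distances, so the slope m of the middle piece is
  a Lipschitz constant.\<close>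

lemma ramp_lipschitz: "\<bar>ramp m a x - ramp m a y\<bar> \<le> real m * \<bar>x - y\<bar>"
proof -
  have "\<bar>ramp m a x - ramp m a y\<bar> \<le> \<bar>real m * (x - a) - real m * (y - a)\<bar>"
    unfolding ramp_def by linarith
  also have "\<dots> = real m * \<bar>x - y\<bar>"
    by (simp flip: right_diff_distrib add: abs_mult)
  finally show ?thesis .
qed

lemma ramp_measurable [measurable]: "ramp m a \<in> borel_measurable borel"
  unfolding ramp_def[abs_def] by measurable

lemma ramp_tendsto_indicator: "(\<lambda>m. ramp m a x) \<longlonglongrightarrow> indicator {..a} x"
proof (cases "x \<le> a")
  case True
  then have "ramp m a x = 1" for m
    by (auto simp: ramp_def mult_nonneg_nonpos)
  with True show ?thesis by simp
next
  case False
  then obtain m0 :: nat where m0: "1 < real m0 * (x - a)"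
    using reals_Archimedean3[of "x - a"] by auto
  have "ramp m a x = 0" if "m0 \<le> m" for m
  proof -
    have "real m0 * (x - a) \<le> real m * (x - a)"
      using False that by (intro mult_right_mono) auto
    with m0 show ?thesis by (simp add: ramp_def)
  qed
  then have "\<forall>\<^sub>F m in sequentially. ramp m a x = indicator {..a} x"
    using False by (auto simp: eventually_sequentially)
  then show ?thesis by (rule tendsto_eventually)
qed

text \<open>Products of numbers in [0, 1] differ by at most the sum of the differences of their
  factors, each at most m |V - S|. Cauchy-Schwarz against the constant 1 bounds the first absolute
  moment by the mean square distance. The bound grows with m, so m stays fixed while k tends to
  infinity.\<close>

lemma (in prob_space) L2_tendsto_prod_ramp:
  assumes J: "finite J"
    and S: "\<And>k j. j \<in> J \<Longrightarrow> sq_integrable M (S k j)"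
    and V: "\<And>j. j \<in> J \<Longrightarrow> V j \<in> borel_measurable M"
    and lim: "\<And>j. j \<in> J \<Longrightarrow> L2_tendsto M (\<lambda>k. S k j) (V j)"
  shows "(\<lambda>k. expectation (\<lambda>\<omega>. \<Prod>j\<in>J. ramp m (a j) (S k j \<omega>))) \<longlonglongrightarrow>
    expectation (\<lambda>\<omega>. \<Prod>j\<in>J. ramp m (a j) (V j \<omega>))"
proof -
  have V': "sq_integrable M (V j)" if "j \<in> J" for j
    using L2_tendsto_sq_integrable[OF V[OF that] S[OF that] lim[OF that]] .
  have [measurable]: "S k j \<in> borel_measurable M" "V j \<in> borel_measurable M" if "j \<in> J" for k j
    using S[OF that] V[OF that] by (auto simp: sq_integrable_def)
  have prod_int: "integrable M (\<lambda>\<omega>. \<Prod>j\<in>J. ramp m (a j) (X j \<omega>))"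
    if [measurable]: "\<And>j. j \<in> J \<Longrightarrow> X j \<in> borel_measurable M" for X :: "_ \<Rightarrow> _ \<Rightarrow> real"
    by (rule integrable_const_bound[of _ 1])
      (auto simp: ramp_bounds prod_nonneg intro!: prod_le_1)
  define d where "d k j = sqrt (\<integral>\<omega>. (V j \<omega> - S k j \<omega>)\<^sup>2 \<partial>M)" for k j
  have d: "(\<lambda>k. d k j) \<longlonglongrightarrow> 0" if "j \<in> J" for j
    using tendsto_real_sqrt[OF lim[OF that, unfolded L2_tendsto_iff_integral[OF V'[OF that] S[OF that]]]]
    by (simp add: d_def)
  have bound: "norm (expectation (\<lambda>\<omega>. \<Prod>j\<in>J. ramp m (a j) (S k j \<omega>)) -
      expectation (\<lambda>\<omega>. \<Prod>j\<in>J. ramp m (a j) (V j \<omega>))) \<le> (\<Sum>j\<in>J. real m * d k j)" for k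
  proof -
    have abs_int: "integrable M (\<lambda>\<omega>. \<bar>V j \<omega> - S k j \<omega>\<bar>)" "(\<integral>\<omega>. \<bar>V j \<omega> - S k j \<omega>\<bar> \<partial>M) \<le> d k j"
      if "j \<in> J" for j
    proof -
      have D: "sq_integrable M (\<lambda>\<omega>. \<bar>V j \<omega> - S k j \<omega>\<bar>)"
        using sq_integrable_diff[OF V'[OF that] S[OF that, of k]] by (auto simp: sq_integrable_def)
      have one: "sq_integrable M (\<lambda>_. 1)"
        by (simp add: sq_integrable_def)
      show "integrable M (\<lambda>\<omega>. \<bar>V j \<omega> - S k j \<omega>\<bar>)"
        using sq_integrable_mult[OF D one] by simp
      show "(\<integral>\<omega>. \<bar>V j \<omega> - S k j \<omega>\<bar> \<partial>M) \<le> d k j"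
        using Cauchy_Schwarz_lebesgue_integral[OF D one] by (simp add: d_def prob_space)
    qed
    have "norm (expectation (\<lambda>\<omega>. \<Prod>j\<in>J. ramp m (a j) (S k j \<omega>)) -
        expectation (\<lambda>\<omega>. \<Prod>j\<in>J. ramp m (a j) (V j \<omega>))) =
        norm (expectation (\<lambda>\<omega>. (\<Prod>j\<in>J. ramp m (a j) (S k j \<omega>)) - (\<Prod>j\<in>J. ramp m (a j) (V j \<omega>))))"
      using prod_int[of "S k"] prod_int[of V] by simp
    also have "\<dots> \<le> expectation (\<lambda>\<omega>. \<Sum>j\<in>J. real m * \<bar>V j \<omega> - S k j \<omega>\<bar>)"
    proof (rule order_trans[OF integral_norm_bound integral_mono])
      show "integrable M (\<lambda>\<omega>. \<Sum>j\<in>J. real m * \<bar>V j \<omega> - S k j \<omega>\<bar>)"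
        using abs_int by auto
      fix \<omega>
      have "norm ((\<Prod>j\<in>J. ramp m (a j) (S k j \<omega>)) - (\<Prod>j\<in>J. ramp m (a j) (V j \<omega>))) \<le>
          (\<Sum>j\<in>J. norm (ramp m (a j) (S k j \<omega>) - ramp m (a j) (V j \<omega>)))"
        by (intro norm_prod_diff) (auto simp: ramp_bounds)
      also have "\<dots> \<le> (\<Sum>j\<in>J. real m * \<bar>V j \<omega> - S k j \<omega>\<bar>)"
        using ramp_lipschitz by (intro sum_mono) (auto simp: abs_minus_commute[of "V _ _"])
      finally show "norm ((\<Prod>j\<in>J. ramp m (a j) (S k j \<omega>)) - (\<Prod>j\<in>J. ramp m (a j) (V j \<omega>))) \<le> \<dots>" .
    qed (use prod_int[of "S k"] prod_int[of V] in auto)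
    also have "\<dots> = (\<Sum>j\<in>J. real m * (\<integral>\<omega>. \<bar>V j \<omega> - S k j \<omega>\<bar> \<partial>M))"
      using abs_int by simp
    also have "\<dots> \<le> (\<Sum>j\<in>J. real m * d k j)"
      using abs_int by (intro sum_mono mult_left_mono) auto
    finally show ?thesis .
  qed
  have "(\<lambda>k. \<Sum>j\<in>J. real m * d k j) \<longlonglongrightarrow> (\<Sum>j\<in>J. real m * 0)"
    by (intro tendsto_intros d)
  then have sum_lim: "(\<lambda>k. \<Sum>j\<in>J. real m * d k j) \<longlonglongrightarrow> 0" by simp
  show ?thesis
    by (rule LIM_zero_cancel[OF Lim_null_comparison[OF always_eventually[OF allI[OF bound]] sum_lim]])
qed

text \<open>Dominated convergence with bound 1; a product of indicators of half-lines is the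
  indicator of the box.\<close>

lemma (in prob_space) prod_ramp_tendsto_measure_PiE:
  fixes V :: "'j \<Rightarrow> 'a \<Rightarrow> real"
  assumes J: "finite J" and V[measurable]: "\<And>j. j \<in> J \<Longrightarrow> V j \<in> borel_measurable M"
  shows "(\<lambda>m. expectation (\<lambda>\<omega>. \<Prod>j\<in>J. ramp m (a j) (V j \<omega>))) \<longlonglongrightarrow>
    measure (distr M (PiM J (\<lambda>_. borel)) (\<lambda>\<omega>. \<lambda>j\<in>J. V j \<omega>)) (Pi\<^sub>E J (\<lambda>j. {..a j}))"
proof -
  have "(\<lambda>m. expectation (\<lambda>\<omega>. \<Prod>j\<in>J. ramp m (a j) (V j \<omega>))) \<longlonglongrightarrow>
      expectation (\<lambda>\<omega>. \<Prod>j\<in>J. indicator {..a j} (V j \<omega>))"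
  proof (rule integral_dominated_convergence[where w = "\<lambda>_. 1"])
    show "AE \<omega> in M. (\<lambda>m. \<Prod>j\<in>J. ramp m (a j) (V j \<omega>)) \<longlonglongrightarrow> (\<Prod>j\<in>J. indicator {..a j} (V j \<omega>))"
      by (intro AE_I2 tendsto_prod ramp_tendsto_indicator)
    show "AE \<omega> in M. norm (\<Prod>j\<in>J. ramp m (a j) (V j \<omega>)) \<le> 1" for m
      by (auto simp: ramp_bounds prod_nonneg intro!: prod_le_1)
  qed auto
  also have "expectation (\<lambda>\<omega>. \<Prod>j\<in>J. indicat_real {..a j} (V j \<omega>)) =
      expectation (indicator ((\<lambda>\<omega>. \<lambda>j\<in>J. V j \<omega>) -` (Pi\<^sub>E J (\<lambda>j. {..a j})) \<inter> space M))"
    using J by (intro Bochner_Integration.integral_cong refl) (auto simp: indicator_def PiE_iff intro!: prod_zero)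
  also have "\<dots> = measure (distr M (PiM J (\<lambda>_. borel)) (\<lambda>\<omega>. \<lambda>j\<in>J. V j \<omega>)) (Pi\<^sub>E J (\<lambda>j. {..a j}))"
    using J by (subst measure_distr) (auto intro!: measurable_restrict sets_PiM_I_finite)
  finally show ?thesis .
qed

text \<open>Boxes of lower half-lines are stable under intersection, generate the product
  \<sigma>-algebra over a finite index set, and countably many of them exhaust the space.\<close>

lemma measure_eqI_PiE_atMost:
  fixes P Q :: "('j \<Rightarrow> real) measure"
  assumes J: "finite J" and sets: "sets P = sets (PiM J (\<lambda>_. borel))" "sets Q = sets (PiM J (\<lambda>_. borel))"
    and fin: "finite_measure P"
    and eq: "\<And>a. emeasure P (Pi\<^sub>E J (\<lambda>j. {..a j})) = emeasure Q (Pi\<^sub>E J (\<lambda>j. {..a j}))"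
  shows "P = Q"
proof -
  let ?E = "{Pi\<^sub>E J (\<lambda>j. {..a j}) |a. True} :: ('j \<Rightarrow> real) set set"
  let ?\<Omega> = "Pi\<^sub>E J (\<lambda>_. UNIV) :: ('j \<Rightarrow> real) set"
  have gen: "sets (PiM J (\<lambda>_. borel :: real measure)) = sigma_sets ?\<Omega> ?E"
  proof -
    have "sets (PiM J (\<lambda>_. borel :: real measure)) =
        sets (PiM J (\<lambda>_. sigma UNIV (range (\<lambda>a::real. {..a}))))"
      by (simp add: borel_eq_atMost)
    \<comment> \<open>\<open>sets_PiM_sigma\<close> asks for a cover of the index set by finite
      blocks; the whole of \<open>J\<close> serves as the only block.\<close>
    also have "\<dots> = sets (sigma ?\<Omega>
        {{f \<in> ?\<Omega>. \<forall>i\<in>j. f i \<in> A i} |A j. j \<in> {J} \<and> A \<in> Pi j (\<lambda>_. range (\<lambda>a::real. {..a}))})"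
    proof (rule sets_PiM_sigma)
      fix i assume "i \<in> J"
      have "x \<in> (\<Union>n::nat. {..real n})" for x :: real
        using real_arch_simple[of x] by auto
      then show "\<exists>S\<subseteq>range (\<lambda>a::real. {..a}). countable S \<and> UNIV = \<Union>S"
        by (intro exI[of _ "range (\<lambda>n::nat. {..real n})"]) auto
    qed (use J in auto)
    also have "{{f \<in> ?\<Omega>. \<forall>i\<in>j. f i \<in> A i} |A j. j \<in> {J} \<and> A \<in> Pi j (\<lambda>_. range (\<lambda>a::real. {..a}))} = ?E"
    proof (intro equalityI subsetI)
      fix X assume "X \<in> {{f \<in> ?\<Omega>. \<forall>i\<in>j. f i \<in> A i} |A j. j \<in> {J} \<and> A \<in> Pi j (\<lambda>_. range (\<lambda>a::real. {..a}))}"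
      then obtain A where X: "X = {f \<in> ?\<Omega>. \<forall>i\<in>J. f i \<in> A i}" and A: "A \<in> J \<rightarrow> range (\<lambda>a::real. {..a})"
        by auto
      from A have "\<forall>i\<in>J. \<exists>a. A i = {..a}" by auto
      then obtain a where "\<forall>i\<in>J. A i = {..a i}" by metis
      then have "X = Pi\<^sub>E J (\<lambda>j. {..a j})"
        by (auto simp: X PiE_iff extensional_def)
      then show "X \<in> ?E" by blast
    next
      fix X assume "X \<in> ?E"
      then obtain a where "X = Pi\<^sub>E J (\<lambda>j. {..a j})" by blast
      then have "X = {f \<in> ?\<Omega>. \<forall>i\<in>J. f i \<in> {..a i}}" by (auto simp: PiE_iff extensional_def)
      then show "X \<in> {{f \<in> ?\<Omega>. \<forall>i\<in>j. f i \<in> A i} |A j. j \<in> {J} \<and> A \<in> Pi j (\<lambda>_. range (\<lambda>a::real. {..a}))}"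
        by (intro CollectI exI[of _ "\<lambda>i. {..a i}"] exI[of _ J]) auto
    qed
    finally show ?thesis
      by (subst (asm) sets_measure_of) auto
  qed
  interpret finite_measure P by fact
  show ?thesis
  proof (rule measure_eqI_generator_eq)
    show "Int_stable ?E"
    proof (rule Int_stableI)
      fix X Y assume "X \<in> ?E" "Y \<in> ?E"
      then obtain a b where "X = Pi\<^sub>E J (\<lambda>j. {..a j})" "Y = Pi\<^sub>E J (\<lambda>j. {..b j})" by blast
      then have "X \<inter> Y = Pi\<^sub>E J (\<lambda>j. {..min (a j) (b j)})"
        by (auto simp: PiE_iff)
      then show "X \<inter> Y \<in> ?E" by (intro CollectI exI[of _ "\<lambda>j. min (a j) (b j)"]) simp
    qed
    show "?E \<subseteq> Pow ?\<Omega>" by auto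
    show "range (\<lambda>n::nat. Pi\<^sub>E J (\<lambda>j. {..real n})) \<subseteq> ?E" by auto
    show "(\<Union>n::nat. Pi\<^sub>E J (\<lambda>j. {..real n})) = ?\<Omega>"
    proof (intro equalityI subsetI)
      fix f assume f: "f \<in> ?\<Omega>"
      \<comment> \<open>\<open>insert 0\<close> makes the maximum meaningful for empty
        \<open>J\<close> as well.\<close>
      obtain n :: nat where "Max (insert 0 (f ` J)) \<le> real n"
        using real_arch_simple by blast
      then have "f j \<le> real n" if "j \<in> J" for j
        using J that by auto
      with f show "f \<in> (\<Union>n::nat. Pi\<^sub>E J (\<lambda>j. {..real n}))"
        by (auto simp: PiE_iff)
    qed auto
    show "emeasure P (Pi\<^sub>E J (\<lambda>j. {..real n})) \<noteq> \<infinity>" for n :: nat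
      by simp
  qed (use eq gen sets in auto)
qed

text \<open>Two successive limits: for fixed m, letting k tend to infinity equates the expectations
  of the ramp products of \<open>V\<close> and \<open>V'\<close>; letting m tend to infinity then
  equates the probabilities of all boxes.\<close>

lemma distr_eq_L2_limit:
  assumes J: "finite J" and M: "prob_space M" and M': "prob_space M'"
    and S: "\<And>k j. j \<in> J \<Longrightarrow> sq_integrable M (S k j)"
    and V: "\<And>j. j \<in> J \<Longrightarrow> V j \<in> borel_measurable M"
    and lim: "\<And>j. j \<in> J \<Longrightarrow> L2_tendsto M (\<lambda>k. S k j) (V j)"
    and S': "\<And>k j. j \<in> J \<Longrightarrow> sq_integrable M' (S' k j)"
    and V': "\<And>j. j \<in> J \<Longrightarrow> V' j \<in> borel_measurable M'"
    and lim': "\<And>j. j \<in> J \<Longrightarrow> L2_tendsto M' (\<lambda>k. S' k j) (V' j)"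
    and eq: "\<And>k. distr M (PiM J (\<lambda>_. borel)) (\<lambda>\<omega>. \<lambda>j\<in>J. S k j \<omega>) =
      distr M' (PiM J (\<lambda>_. borel)) (\<lambda>\<omega>. \<lambda>j\<in>J. S' k j \<omega>)"
  shows "distr M (PiM J (\<lambda>_. borel)) (\<lambda>\<omega>. \<lambda>j\<in>J. V j \<omega>) =
    distr M' (PiM J (\<lambda>_. borel)) (\<lambda>\<omega>. \<lambda>j\<in>J. V' j \<omega>)" (is "?P = ?Q")
proof -
  interpret M: prob_space M by fact
  interpret M': prob_space M' by fact
  have mV: "(\<lambda>\<omega>. \<lambda>j\<in>J. V j \<omega>) \<in> M \<rightarrow>\<^sub>M PiM J (\<lambda>_. borel)"
    using V by (intro measurable_restrict)
  have mV': "(\<lambda>\<omega>. \<lambda>j\<in>J. V' j \<omega>) \<in> M' \<rightarrow>\<^sub>M PiM J (\<lambda>_. borel)"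
    using V' by (intro measurable_restrict)
  interpret P: prob_space ?P by (rule M.prob_space_distr[OF mV])
  interpret Q: prob_space ?Q by (rule M'.prob_space_distr[OF mV'])
  have approx: "M.expectation (\<lambda>\<omega>. \<Prod>j\<in>J. ramp m (a j) (S k j \<omega>)) =
      M'.expectation (\<lambda>\<omega>. \<Prod>j\<in>J. ramp m (a j) (S' k j \<omega>))" for m k a
  proof -
    let ?f = "\<lambda>y. \<Prod>j\<in>J. ramp m (a j) (y j)"
    have f: "?f \<in> borel_measurable (PiM J (\<lambda>_. borel))" by measurable
    have mS: "(\<lambda>\<omega>. \<lambda>j\<in>J. S k j \<omega>) \<in> M \<rightarrow>\<^sub>M PiM J (\<lambda>_. borel)"
      using S by (intro measurable_restrict) (auto simp: sq_integrable_def)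
    have mS': "(\<lambda>\<omega>. \<lambda>j\<in>J. S' k j \<omega>) \<in> M' \<rightarrow>\<^sub>M PiM J (\<lambda>_. borel)"
      using S' by (intro measurable_restrict) (auto simp: sq_integrable_def)
    show ?thesis
      using integral_distr[OF mS f] integral_distr[OF mS' f] eq[of k] by simp
  qed
  have limit: "M.expectation (\<lambda>\<omega>. \<Prod>j\<in>J. ramp m (a j) (V j \<omega>)) =
      M'.expectation (\<lambda>\<omega>. \<Prod>j\<in>J. ramp m (a j) (V' j \<omega>))" for m a
    using M.L2_tendsto_prod_ramp[where S = S and V = V and m = m and a = a, OF J S V lim] M'.L2_tendsto_prod_ramp[where S = S' and V = V' and m = m and a = a, OF J S' V' lim']
    unfolding approx by (rule LIMSEQ_unique)
  have box: "measure ?P (Pi\<^sub>E J (\<lambda>j. {..a j})) = measure ?Q (Pi\<^sub>E J (\<lambda>j. {..a j}))" for a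
    using M.prod_ramp_tendsto_measure_PiE[where V = V and a = a, OF J V] M'.prod_ramp_tendsto_measure_PiE[where V = V' and a = a, OF J V']
    unfolding limit by (rule LIMSEQ_unique)
  show ?thesis
  proof (rule measure_eqI_PiE_atMost[OF J])
    show "finite_measure ?P" by (rule P.finite_measure)
    show "emeasure ?P (Pi\<^sub>E J (\<lambda>j. {..a j})) = emeasure ?Q (Pi\<^sub>E J (\<lambda>j. {..a j}))" for a
      by (simp add: P.emeasure_eq_measure Q.emeasure_eq_measure box)
  qed simp_all
qed

section \<open>Covariances and coefficients\<close>

text \<open>Agreement extends to the closure by continuity. The variables of the covariance can be
  separated only on the open interval, and the endpoint values are recovered from here.\<close>

lemma continuous_on_Icc_eqI:
  fixes f g :: "real \<Rightarrow> real"
  assumes "continuous_on {a..b} f" "continuous_on {a..b} g" "a < b"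
    and "\<And>x. x \<in> {a<..<b} \<Longrightarrow> f x = g x" and "x \<in> {a..b}"
  shows "f x = g x"
proof -
  have "f x - g x = 0"
    by (rule continuous_constant_on_closure[of "{a<..<b}" "\<lambda>x. f x - g x"])
      (use assms in \<open>auto intro: continuous_intros\<close>)
  then show ?thesis by simp
qed

text \<open>Gives uniqueness of derivatives within [a, b], also at the endpoints, where they are
  one-sided.\<close>

lemma at_within_Icc_neq_bot:
  fixes a b x :: real
  assumes "a < b" "x \<in> {a..b}"
  shows "at x within {a..b} \<noteq> bot"
  using assms trivial_limit_within[of x "{a..b}"] by (simp add: trivial_limit_def islimpt_Icc)

text \<open>Since G has derivative -g, the function 1 / G has derivative g / G^2. The lemma serves
  both kernels: for the Wiener bridge, G(x) is T - x.\<close>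

lemma integral_div_square:
  fixes G g :: "real \<Rightarrow> real"
  assumes "0 \<le> s" and G: "\<And>x. x \<in> {0..s} \<Longrightarrow> (G has_real_derivative - g x) (at x within {0..s})"
    and g: "continuous_on {0..s} g" and nz: "\<And>x. x \<in> {0..s} \<Longrightarrow> G x \<noteq> 0"
  shows "(\<integral>x. indicator {0..s} x * (g x / (G x)\<^sup>2) \<partial>lborel) = 1 / G s - 1 / G 0"
proof -
  have "continuous_on {0..s} G"
    using G by (rule DERIV_continuous_on)
  then have c: "continuous_on {0..s} (\<lambda>x. g x / (G x)\<^sup>2)"
    using g nz by (auto intro!: continuous_intros)
  have "(\<integral>x. indicator {0..s} x *\<^sub>R (g x / (G x)\<^sup>2) \<partial>lborel) = 1 / G s - 1 / G 0"
  proof (rule integral_FTC_atLeastAtMost[OF \<open>0 \<le> s\<close> _ c])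
    fix x assume "0 \<le> x" "x \<le> s"
    then show "((\<lambda>x. 1 / G x) has_vector_derivative g x / (G x)\<^sup>2) (at x within {0..s})"
      unfolding has_real_derivative_iff_has_vector_derivative[symmetric]
      using nz[of x] by (auto intro!: derivative_eq_intros G simp: power2_eq_square)
  qed
  then show ?thesis by simp
qed

section \<open>Deterministic analysis of the bridge kernel\<close>

locale ou_coefficients =
  fixes T :: real and q \<sigma> :: "real \<Rightarrow> real"
  assumes T: "0 < T" and q: "continuous_on {0..T} q" and \<sigma>: "continuous_on {0..T} \<sigma>"
    and \<sigma>_nz: "\<And>t. t \<in> {0..T} \<Longrightarrow> \<sigma> t \<noteq> 0"
begin

definition E :: "real \<Rightarrow> real" where "E t = exp (qbar q t)"

definition G :: "real \<Rightarrow> real" where "G t = integral {t..T} (\<lambda>u. (\<sigma> u)\<^sup>2 / (E u)\<^sup>2)"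

definition bridge_kernel :: "real \<Rightarrow> real \<Rightarrow> real" where
  "bridge_kernel t s = ou_gamma q \<sigma> t T / ou_gamma q \<sigma> s T * exp (qbar q t - qbar q s) * \<sigma> s"

lemma E_pos: "0 < E t"
  by (simp add: E_def)

lemma E_0: "E 0 = 1"
  by (simp add: E_def qbar_def)

lemma E_deriv: "t \<in> {0..T} \<Longrightarrow> (E has_real_derivative E t * q t) (at t within {0..T})"
  unfolding E_def[abs_def] qbar_def
  by (auto intro!: derivative_eq_intros integral_has_real_derivative q)

lemma E_cont: "continuous_on {0..T} E"
  using E_deriv by (rule DERIV_continuous_on)

lemma dens_cont: "continuous_on {0..T} (\<lambda>u. (\<sigma> u)\<^sup>2 / (E u)\<^sup>2)"
  using E_pos by (auto intro!: continuous_intros \<sigma> E_cont simp: less_imp_neq[symmetric])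

lemma G_deriv: "t \<in> {0..T} \<Longrightarrow> (G has_real_derivative - ((\<sigma> t)\<^sup>2 / (E t)\<^sup>2)) (at t within {0..T})"
  unfolding G_def[abs_def] by (rule integral_has_real_derivative'[OF dens_cont])

lemma G_cont: "continuous_on {0..T} G"
  using G_deriv by (rule DERIV_continuous_on)

text \<open>Strict because \<sigma> has no zero. The endpoint T is excluded, as G vanishes
  there.\<close>

lemma G_pos:
  assumes "t \<in> {0..<T}"
  shows "0 < G t"
proof -
  have "integral {t..T} (\<lambda>_. 0) < integral {t..T} (\<lambda>u. (\<sigma> u)\<^sup>2 / (E u)\<^sup>2)"
    using assms E_pos \<sigma>_nz
    by (intro integral_less_real continuous_on_subset[OF dens_cont]) (auto simp: less_imp_neq[symmetric])
  then show ?thesis by (simp add: G_def)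
qed

text \<open>The exponential splits into E(T)^2 / E(u)^2. The factor E(T)^2 does not depend on t, so
  it cancels in the quotient that forms the kernel.\<close>

lemma ou_gamma_eq: "ou_gamma q \<sigma> t T = (E T)\<^sup>2 * G t"
proof -
  have "ou_gamma q \<sigma> t T = integral {t..T} (\<lambda>u. (E T)\<^sup>2 * ((\<sigma> u)\<^sup>2 / (E u)\<^sup>2))"
    unfolding ou_gamma_def
    by (intro Henstock_Kurzweil_Integration.integral_cong)
      (simp add: E_def exp_diff right_diff_distrib exp_double)
  then show ?thesis by (simp only: G_def integral_mult_right)
qed

lemma kernel_eq: "bridge_kernel t s = G t / G s * (E t / E s) * \<sigma> s"
  using E_pos[of T] by (simp add: bridge_kernel_def ou_gamma_eq E_def exp_diff)

text \<open>On [0, s] the product of the two kernels is a constant times (\<sigma>^2 / E^2) / G^2,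
  which is the derivative of 1 / G. The condition t < T keeps G away from 0.\<close>

lemma kernel_covariance:
  assumes "0 \<le> s" "s \<le> t" "t < T"
  shows "(\<integral>x. (indicator {0..s} x * bridge_kernel s x) * (indicator {0..t} x * bridge_kernel t x) \<partial>lborel) =
    G t * E t * (E s * (1 - G s / G 0))"
proof -
  have e: "(indicator {0..s} x * bridge_kernel s x) * (indicator {0..t} x * bridge_kernel t x) =
      G s * E s * (G t * E t) * (indicator {0..s} x * (((\<sigma> x)\<^sup>2 / (E x)\<^sup>2) / (G x)\<^sup>2))" for x
    using assms by (auto simp: indicator_def kernel_eq power2_eq_square mult_ac)
  have "(\<integral>x. (indicator {0..s} x * bridge_kernel s x) * (indicator {0..t} x * bridge_kernel t x) \<partial>lborel) =
      G s * E s * (G t * E t) * (\<integral>x. indicator {0..s} x * (((\<sigma> x)\<^sup>2 / (E x)\<^sup>2) / (G x)\<^sup>2) \<partial>lborel)"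
    by (simp only: e integral_mult_right_zero)
  also have "(\<integral>x. indicator {0..s} x * (((\<sigma> x)\<^sup>2 / (E x)\<^sup>2) / (G x)\<^sup>2) \<partial>lborel) = 1 / G s - 1 / G 0"
  proof (rule integral_div_square)
    fix x assume x: "x \<in> {0..s}"
    then show "(G has_real_derivative - ((\<sigma> x)\<^sup>2 / (E x)\<^sup>2)) (at x within {0..s})"
      using assms by (intro DERIV_subset[OF G_deriv]) auto
    show "G x \<noteq> 0" using x assms G_pos[of x] by auto
  qed (use assms in \<open>auto intro: continuous_on_subset[OF dens_cont]\<close>)
  also have "G s * E s * (G t * E t) * (1 / G s - 1 / G 0) = G t * E t * (E s * (1 - G s / G 0))"
    using G_pos[of s] G_pos[of 0] assms T by (simp add: field_simps)
  finally show ?thesis .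
qed

text \<open>By the intermediate value property a change of sign would force a zero of
  \<sigma>.\<close>

lemma \<sigma>_constant_sign:
  assumes "\<And>t. t \<in> {0..<T} \<Longrightarrow> (\<sigma> t)\<^sup>2 = 1"
  shows "(\<forall>t\<in>{0..<T}. \<sigma> t = 1) \<or> (\<forall>t\<in>{0..<T}. \<sigma> t = -1)"
proof (rule ccontr)
  assume neg: "\<not> ?thesis"
  then obtain x y where xy: "x \<in> {0..<T}" "\<sigma> x \<noteq> 1" "y \<in> {0..<T}" "\<sigma> y \<noteq> -1" by auto
  then have "\<sigma> x = -1" "\<sigma> y = 1"
    using assms[of x] assms[of y] by (auto simp: power2_eq_1_iff)
  moreover have "connected (\<sigma> ` {0..<T})"
    by (intro connected_continuous_image continuous_on_subset[OF \<sigma>]) auto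
  ultimately have "{-1..1} \<subseteq> \<sigma> ` {0..<T}"
    using xy(1,3) by (intro connected_contains_Icc) force+
  then have "0 \<in> \<sigma> ` {0..<T}" by auto
  then show False using \<sigma>_nz by force
qed

text \<open>The parameter \<kappa>, the reciprocal of C, treats the two shapes 1 / (t + C) and 0 of
  q at once, with one condition on its range.\<close>

lemma coefficients_of_covariance:
  assumes cov: "\<And>s t. 0 \<le> s \<Longrightarrow> s \<le> t \<Longrightarrow> t < T \<Longrightarrow> G t * E t * (E s * (1 - G s / G 0)) = (T - t) * s / T"
  obtains \<kappa> where "0 < 1 + \<kappa> * T" "\<And>t. t \<in> {0..<T} \<Longrightarrow> q t = \<kappa> / (1 + \<kappa> * t)"
    "\<And>t. t \<in> {0..<T} \<Longrightarrow> (\<sigma> t)\<^sup>2 = 1"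
proof -
  define a where "a t = G t * E t" for t
  define b where "b s = E s * (1 - G s / G 0)" for s
  \<comment> \<open>The factor of proportionality between \<open>a t\<close> and T - t, read off at
    the midpoint, which stands for any interior point.\<close>
  define c where "c = a (T / 2) / (T / 2)"
  have G0: "0 < G 0" using G_pos[of 0] T by simp
  have ab: "a t * b s = (T - t) * s / T" if "0 \<le> s" "s \<le> t" "t < T" for s t
    using cov[OF that] by (simp add: a_def b_def)
  have a_pos: "0 < a t" if "t \<in> {0..<T}" for t
    using G_pos[OF that] E_pos by (simp add: a_def)
  \<comment> \<open>Multiplied by \<open>b s\<close>, both quotients become s / T;
    \<open>b s\<close> can be cancelled because \<open>a s * b s\<close> is positive, which requires
    s > 0.\<close>
  have ratio: "a t / (T - t) = a s / (T - s)" if "0 < s" "s \<le> t" "t < T" for s t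
  proof -
    have "0 < a s * b s" using ab[of s s] that by simp
    then have "b s \<noteq> 0" by auto
    moreover have "a t / (T - t) * b s = s / T" "a s / (T - s) * b s = s / T"
      using ab[of s t] ab[of s s] that by (simp_all add: field_simps)
    ultimately show ?thesis
      using mult_right_cancel[of "b s" "a t / (T - t)" "a s / (T - s)"] by simp
  qed
  have a: "a t = c * (T - t)" if "t \<in> {0<..<T}" for t
  proof -
    \<comment> \<open>\<open>ratio\<close> needs its two times in increasing order, hence the case
      distinction.\<close>
    have "a t / (T - t) = a (T / 2) / (T - T / 2)"
      using ratio[of "T / 2" t] ratio[of t "T / 2"] that T by (cases "t \<le> T / 2") auto
    then show ?thesis using that by (simp add: c_def field_simps)
  qed
  have c: "0 < c" using a_pos[of "T / 2"] T by (simp add: c_def)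
  have b: "b t = t / (T * c)" if t: "t \<in> {0<..<T}" for t
  proof -
    have "(T - t) * (c * b t) = (T - t) * (t / T)"
      using ab[of t t] a[OF t] t by (simp add: mult_ac)
    then have "c * b t = t / T"
      by (subst (asm) mult_left_cancel) (use t in auto)
    then show ?thesis using c T by (simp add: field_simps)
  qed
  define \<kappa> where "\<kappa> = 1 / (T * c) - 1 / T"
  have E_affine: "E t = c * T / G 0 * (1 - t / T) + t / (T * c)" if t: "t \<in> {0<..<T}" for t
  proof -
    have "E t = b t + a t / G 0"
      using G0 by (simp add: a_def b_def field_simps)
    also have "\<dots> = c * T / G 0 * (1 - t / T) + t / (T * c)"
      using T G0 by (simp add: a[OF t] b[OF t] field_simps)
    finally show ?thesis .
  qed
  have E_affine': "E t = c * T / G 0 * (1 - t / T) + t / (T * c)" if t: "t \<in> {0..T}" for t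
    by (rule continuous_on_Icc_eqI[OF E_cont _ T E_affine t]) (use T c G0 in \<open>auto intro!: continuous_intros\<close>)
  \<comment> \<open>Evaluation at 0, where E is 1. The formula reaches this endpoint only after the
    extension by continuity.\<close>
  have cG: "c * T / G 0 = 1" using E_affine'[of 0] T E_0 c by simp
  have E: "E t = 1 + \<kappa> * t" if t: "t \<in> {0..T}" for t
    using E_affine'[OF t] T c unfolding cG by (simp add: \<kappa>_def field_simps)
  have E_T: "1 + \<kappa> * T = 1 / c" using T c by (simp add: \<kappa>_def field_simps)
  have pos: "0 < 1 + \<kappa> * t" if "t \<in> {0..T}" for t
    using E[OF that] E_pos[of t] by simp
  have q_eq: "q t = \<kappa> / (1 + \<kappa> * t)" if t: "t \<in> {0..<T}" for t
  proof -
    \<comment> \<open>A second computation of the derivative of E, now from the affine formula;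
      comparison with E q determines q. The radius 1 of the neighbourhood is arbitrary.\<close>
    have "(E has_real_derivative \<kappa>) (at t within {0..T})"
      by (rule has_field_derivative_transform_within[of "\<lambda>t. 1 + \<kappa> * t" _ _ _ 1])
        (use t E in \<open>auto intro!: derivative_eq_intros\<close>)
    then have "E t * q t = \<kappa>"
      using has_field_derivative_unique[OF E_deriv[of t] _ at_within_Icc_neq_bot[of 0 T t]] t by auto
    then show ?thesis using E[of t] pos[of t] t by (auto simp: field_simps)
  qed
  have G_eq: "G t = c * (T - t) / (1 + \<kappa> * t)" if t: "t \<in> {0..T}" for t
  proof (rule continuous_on_Icc_eqI[OF G_cont _ T _ t])
    show "continuous_on {0..T} (\<lambda>t. c * (T - t) / (1 + \<kappa> * t))"
      using pos by (auto intro!: continuous_intros simp: less_imp_neq[symmetric])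
    fix t assume "t \<in> {0<..<T}"
    then show "G t = c * (T - t) / (1 + \<kappa> * t)"
      using a[of t] E[of t] pos[of t] by (auto simp: a_def field_simps)
  qed
  have \<sigma>_eq: "(\<sigma> t)\<^sup>2 = 1" if t: "t \<in> {0..<T}" for t
  proof -
    have p: "0 < 1 + \<kappa> * t" using pos[of t] t by auto
    have "((\<lambda>t. c * (T - t) / (1 + \<kappa> * t)) has_real_derivative
        (- c * (1 + \<kappa> * t) - c * (T - t) * \<kappa>) / (1 + \<kappa> * t)\<^sup>2) (at t within {0..T})"
      using p by (auto intro!: derivative_eq_intros simp: power2_eq_square)
    \<comment> \<open>The terms in t cancel in the numerator, and 1 + \<kappa> T = 1 / c leaves
      -1.\<close>
    moreover have "- c * (1 + \<kappa> * t) - c * (T - t) * \<kappa> = - c * (1 + \<kappa> * T)"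
      by (simp add: algebra_simps)
    moreover have "\<dots> = -1" using E_T c by simp
    ultimately have "((\<lambda>t. c * (T - t) / (1 + \<kappa> * t)) has_real_derivative
        - 1 / (1 + \<kappa> * t)\<^sup>2) (at t within {0..T})"
      by metis
    then have "(G has_real_derivative - 1 / (1 + \<kappa> * t)\<^sup>2) (at t within {0..T})"
      by (rule has_field_derivative_transform_within[of _ _ _ _ 1]) (use t G_eq in auto)
    \<comment> \<open>The two expressions for the derivative of G agree, and E(t) = 1 + \<kappa> t
      makes the denominators equal.\<close>
    then have "- 1 / (1 + \<kappa> * t)\<^sup>2 = - ((\<sigma> t)\<^sup>2 / (E t)\<^sup>2)"
      using has_field_derivative_unique[OF G_deriv[of t] _ at_within_Icc_neq_bot[of 0 T t]] t by auto
    then show ?thesis using E[of t] p t by (auto simp: field_simps)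
  qed
  show ?thesis
    using that[of \<kappa>] pos[of T] T q_eq \<sigma>_eq by auto
qed

text \<open>The factors 1 + \<kappa> u of G and E cancel in G(u) E(u) = (T - u) / (1 + \<kappa> T),
  and the constant denominator cancels in the kernel.\<close>

lemma kernel_of_coefficients:
  assumes \<kappa>: "0 < 1 + \<kappa> * T" and q_eq: "\<And>t. t \<in> {0..<T} \<Longrightarrow> q t = \<kappa> / (1 + \<kappa> * t)"
    and \<sigma>_eq: "\<And>t. t \<in> {0..<T} \<Longrightarrow> (\<sigma> t)\<^sup>2 = 1"
    and t: "t \<in> {0..<T}" and s: "s \<in> {0..t}"
  shows "bridge_kernel t s = (T - t) / (T - s) * \<sigma> s"
proof -
  have pos: "0 < 1 + \<kappa> * u" if "u \<in> {0..T}" for u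
  proof -
    \<comment> \<open>A convex combination of the values at 0 and at T, both of which are
      positive.\<close>
    have "1 + \<kappa> * u = (1 - u / T) + u / T * (1 + \<kappa> * T)"
      using T by (simp add: field_simps)
    moreover have "0 < (1 - u / T) + u / T * (1 + \<kappa> * T)"
      using that T \<kappa> by (cases "u = 0") (auto intro!: add_nonneg_pos mult_pos_pos)
    ultimately show ?thesis by simp
  qed
  have E: "E u = 1 + \<kappa> * u" if u: "u \<in> {0..<T}" for u
  proof -
    have "(q has_integral ln (1 + \<kappa> * u) - ln (1 + \<kappa> * 0)) {0..u}"
    proof (rule fundamental_theorem_of_calculus)
      fix x assume x: "x \<in> {0..u}"
      show "((\<lambda>x. ln (1 + \<kappa> * x)) has_vector_derivative q x) (at x within {0..u})"
        unfolding has_real_derivative_iff_has_vector_derivative[symmetric]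
        using x u pos[of x] q_eq[of x] by (auto intro!: derivative_eq_intros)
    qed (use u in auto)
    then have "qbar q u = ln (1 + \<kappa> * u)"
      by (simp add: qbar_def integral_unique)
    then show ?thesis using pos[of u] u by (simp add: E_def)
  qed
  have G: "G u = (T - u) / ((1 + \<kappa> * T) * (1 + \<kappa> * u))" if u: "u \<in> {0..<T}" for u
  proof -
    \<comment> \<open>The antiderivative x / (1 + \<kappa> x) involves no division by \<kappa>, so
      \<kappa> = 0 is covered.\<close>
    have "((\<lambda>x. 1 / (1 + \<kappa> * x)\<^sup>2) has_integral T / (1 + \<kappa> * T) - u / (1 + \<kappa> * u)) {u..T}"
    proof (rule fundamental_theorem_of_calculus)
      fix x assume x: "x \<in> {u..T}"
      show "((\<lambda>x. x / (1 + \<kappa> * x)) has_vector_derivative 1 / (1 + \<kappa> * x)\<^sup>2) (at x within {u..T})"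
        unfolding has_real_derivative_iff_has_vector_derivative[symmetric]
        using x u pos[of x] by (auto intro!: derivative_eq_intros simp: power2_eq_square)
    qed (use u in auto)
    then have "((\<lambda>x. (\<sigma> x)\<^sup>2 / (E x)\<^sup>2) has_integral T / (1 + \<kappa> * T) - u / (1 + \<kappa> * u)) {u..T}"
      \<comment> \<open>The coefficients are described only before T, so the integrands are compared
        off this single point.\<close>
      by (rule has_integral_spike_finite[of "{T}", rotated 2]) (use u E \<sigma>_eq in auto)
    then have "G u = T / (1 + \<kappa> * T) - u / (1 + \<kappa> * u)"
      by (simp add: G_def integral_unique)
    also have "\<dots> = (T - u) / ((1 + \<kappa> * T) * (1 + \<kappa> * u))"
      using \<kappa> pos[of u] u by (simp add: field_simps)
    finally show ?thesis .
  qed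
  have GE: "G u * E u = (T - u) / (1 + \<kappa> * T)" if "u \<in> {0..<T}" for u
    using E[OF that] G[OF that] pos[of u] that \<kappa> by (simp add: divide_simps mult_ac)
  have "bridge_kernel t s = (G t * E t) / (G s * E s) * \<sigma> s"
    by (simp add: kernel_eq)
  also have "\<dots> = (T - t) / (T - s) * \<sigma> s"
    using s t \<kappa> by (simp add: GE)
  finally show ?thesis .
qed

end

lemma wiener_kernel_covariance:
  fixes T :: real
  assumes "0 \<le> s" "s \<le> t" "t < T"
  shows "(\<integral>x. (indicator {0..s} x * ((T - s) / (T - x))) * (indicator {0..t} x * ((T - t) / (T - x))) \<partial>lborel) =
    (T - t) * s / T"
proof -
  have e: "(indicator {0..s} x * ((T - s) / (T - x))) * (indicator {0..t} x * ((T - t) / (T - x))) =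
      (T - s) * (T - t) * (indicator {0..s} x * (1 / (T - x)\<^sup>2))" for x
    using assms by (auto simp: indicator_def power2_eq_square)
  then have "(\<integral>x. (indicator {0..s} x * ((T - s) / (T - x))) * (indicator {0..t} x * ((T - t) / (T - x))) \<partial>lborel) =
      (T - s) * (T - t) * (\<integral>x. indicator {0..s} x * (1 / (T - x)\<^sup>2) \<partial>lborel)"
    by (simp only: e integral_mult_right_zero)
  \<comment> \<open>\<open>T - 0\<close> is left unsimplified to match 1 / G(0) for G(x) = T - x and
    g(x) = 1.\<close>
  also have "(\<integral>x. indicator {0..s} x * (1 / (T - x)\<^sup>2) \<partial>lborel) = 1 / (T - s) - 1 / (T - 0)"
    by (rule integral_div_square) (use assms in \<open>auto intro!: derivative_eq_intros\<close>)
  also have "(T - s) * (T - t) * (1 / (T - s) - 1 / (T - 0)) = (T - t) * s / T"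
    using assms by (simp add: field_simps)
  finally show ?thesis .
qed

section \<open>Laws of bridges\<close>

text \<open>The centred normal density is even, and negation preserves independence and
  continuity.\<close>

lemma wiener_process_uminus:
  assumes W: "wiener_process M B"
  shows "wiener_process M (\<lambda>t \<omega>. - B t \<omega>)"
proof -
  interpret prob_space M using W by (auto simp: wiener_process_def)
  have "indep_vars (\<lambda>_. borel) (\<lambda>i \<omega>. - B (p (Suc i)) \<omega> - - B (p i) \<omega>) {..<n}"
    if "0 \<le> p 0" "\<forall>i<n. p i \<le> p (Suc i)" for p :: "nat \<Rightarrow> real" and n
  proof -
    have "indep_vars (\<lambda>_. borel) (\<lambda>i \<omega>. B (p (Suc i)) \<omega> - B (p i) \<omega>) {..<n}"
      using W that by (auto simp: wiener_process_def)
    from indep_vars_compose2[OF this, of "\<lambda>_. uminus" "\<lambda>_. borel"] show ?thesis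
      by simp
  qed
  moreover have "distributed M lborel (\<lambda>\<omega>. - B t \<omega> - - B s \<omega>) (\<lambda>x. ennreal (normal_density 0 (sqrt (t - s)) x))"
    if "0 \<le> s" "s < t" for s t
  proof -
    have "distributed M lborel (\<lambda>\<omega>. B t \<omega> - B s \<omega>) (\<lambda>x. ennreal (normal_density 0 (sqrt (t - s)) x))"
      using W that by (auto simp: wiener_process_def)
    from distributed_affine[OF this, of "-1" 0] show ?thesis
      by (simp add: normal_density_def divide_ennreal_def)
  qed
  ultimately show ?thesis
    using W by (auto simp: wiener_process_def intro: continuous_on_minus)
qed

text \<open>Negating the coefficients together with the process leaves every elementary integral
  unchanged, so the same \<open>I\<close> is the limit.\<close>

lemma has_wiener_integral_uminus:
  assumes "has_wiener_integral M B f a b I"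
  shows "has_wiener_integral M (\<lambda>t \<omega>. - B t \<omega>) (\<lambda>x. - f x) a b I"
proof -
  have step: "step_fun n p (\<lambda>i. - c i) x = - step_fun n p c x" for n p c x
    by (simp add: step_fun_def sum_negf)
  have wstep: "step_wiener_integral (\<lambda>t \<omega>. - B t \<omega>) n p (\<lambda>i. - c i) \<omega> = step_wiener_integral B n p c \<omega>"
    for n p c \<omega>
    unfolding step_wiener_integral_def by (intro sum.cong refl) (simp add: algebra_simps)
  have sq: "(- x - - y)\<^sup>2 = (x - y)\<^sup>2" for x y :: real
    by (simp add: power2_eq_square algebra_simps)
  from assms obtain n p c where
    p: "\<forall>k. p k 0 = a \<and> p k (n k) = b \<and> (\<forall>i<n k. p k i \<le> p k (Suc i))" and
    f: "(\<lambda>k. \<integral>\<^sup>+x\<in>{a..b}. ennreal ((f x - step_fun (n k) (p k) (c k) x)\<^sup>2) \<partial>lborel) \<longlonglongrightarrow> 0" and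
    I: "(\<lambda>k. \<integral>\<^sup>+\<omega>. ennreal ((I \<omega> - step_wiener_integral B (n k) (p k) (c k) \<omega>)\<^sup>2) \<partial>M) \<longlonglongrightarrow> 0"
    unfolding has_wiener_integral_def by blast
  have "set_borel_measurable lborel {a..b} (\<lambda>x. - f x)" "I \<in> borel_measurable M"
    using assms by (auto simp: has_wiener_integral_def set_borel_measurable_def)
  moreover have "(\<lambda>k. \<integral>\<^sup>+x\<in>{a..b}. ennreal ((- f x - step_fun (n k) (p k) (\<lambda>i. - c k i) x)\<^sup>2) \<partial>lborel) \<longlonglongrightarrow> 0"
    using f unfolding step sq .
  moreover have "(\<lambda>k. \<integral>\<^sup>+\<omega>. ennreal ((I \<omega> -
      step_wiener_integral (\<lambda>t \<omega>. - B t \<omega>) (n k) (p k) (\<lambda>i. - c k i) \<omega>)\<^sup>2) \<partial>M) \<longlonglongrightarrow> 0"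
    using I unfolding wstep .
  ultimately show ?thesis
    unfolding has_wiener_integral_def using p
    by (intro conjI exI[of _ n] exI[of _ p] exI[of _ "\<lambda>k i. - c k i"])
qed

lemma integral_bridge_uminus:
  "integral_bridge M B k T U \<Longrightarrow> integral_bridge M (\<lambda>t \<omega>. - B t \<omega>) (\<lambda>t s. - k t s) T U"
  unfolding integral_bridge_def using has_wiener_integral_uminus by fast

text \<open>By the isometry, the step functions that approximate the first bridge also approximate the second
  one, although \<^const>\<open>has_wiener_integral\<close> provides each process with its own approximation.\<close>

lemma integral_bridge_same_fdd:
  assumes W: "wiener_process M B" and W': "wiener_process M' B'"
    and U: "integral_bridge M B k T U" and U': "integral_bridge M' B' k' T U'"
    and k: "\<And>t s. t \<in> {0..<T} \<Longrightarrow> s \<in> {0..t} \<Longrightarrow> k t s = k' t s"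
  shows "same_fdd T M U M' U'"
  unfolding same_fdd_def
proof (intro allI impI)
  fix J assume J: "finite J \<and> J \<subseteq> {0..T}"
  have "\<exists>n p c. wiener_approximates M B (k t) t (U t) n p c" if "t \<in> {0..<T}" for t
  proof -
    have "has_wiener_integral M B (k t) 0 t (U t)"
      using U that by (auto simp: integral_bridge_def)
    from this obtain n p c where "wiener_approximates M B (k t) t (U t) n p c"
      by (rule has_wiener_integralE[OF W])
    then show ?thesis by (intro exI)
  qed
  then obtain n p c where approx: "\<And>t. t \<in> {0..<T} \<Longrightarrow> wiener_approximates M B (k t) t (U t) (n t) (p t) (c t)"
    by metis
  have part: "partition_of (n t l) (p t l) 0 t" if "t \<in> {0..<T}" for t l
    using approx[OF that] by (auto simp: wiener_approximates_def[OF W])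
  \<comment> \<open>At t = T both bridges are 0 by definition, so the zero sequence approximates
    them. \<open>S'\<close> below reuses the partitions and coefficients of the first bridge with
    the other driving process.\<close>
  define S where "S l t = (if t < T then step_wiener_integral B (n t l) (p t l) (c t l) else (\<lambda>_. 0))" for l t
  define S' where "S' l t = (if t < T then step_wiener_integral B' (n t l) (p t l) (c t l) else (\<lambda>_. 0))" for l t
  show "distr M (PiM J (\<lambda>_. borel)) (\<lambda>\<omega>. \<lambda>t\<in>J. U t \<omega>) = distr M' (PiM J (\<lambda>_. borel)) (\<lambda>\<omega>. \<lambda>t\<in>J. U' t \<omega>)"
  proof (rule distr_eq_L2_limit[where S = S and S' = S'])
    show "prob_space M" "prob_space M'"
      using W W' by (auto simp: wiener_process_def)
    fix t assume t: "t \<in> J"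
    show "U t \<in> borel_measurable M" "U' t \<in> borel_measurable M'"
      using t J U U' by (auto simp: integral_bridge_def ae_continuous_process_def)
    show "sq_integrable M (S l t)" "sq_integrable M' (S' l t)" for l
      using t J part sq_integrable_step_wiener_integral[OF W part order_refl]
        sq_integrable_step_wiener_integral[OF W' part order_refl]
      by (auto simp: S_def S'_def sq_integrable_def)
    show "L2_tendsto M (\<lambda>l. S l t) (U t)"
    proof (cases "t < T")
      case True
      then show ?thesis
        using approx[of t] t J by (auto simp: wiener_approximates_def[OF W] S_def)
    next
      case False
      then have "t = T" using t J by auto
      then have "(\<integral>\<^sup>+\<omega>. ennreal ((U t \<omega>)\<^sup>2) \<partial>M) = 0"
        using U by (intro nn_integral_zero') (auto simp: integral_bridge_def)
      then show ?thesis using False by (simp add: S_def L2_tendsto_def)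
    qed
    show "L2_tendsto M' (\<lambda>l. S' l t) (U' t)"
    proof (cases "t < T")
      case True
      then have t': "t \<in> {0..<T}" using t J by auto
      have "L2_tendsto M' (\<lambda>l. step_wiener_integral B' (n t l) (p t l) (c t l)) (U' t)"
      proof (rule L2_tendsto_step_wiener_integral[OF W'])
        show "has_wiener_integral M' B' (k' t) 0 t (U' t)"
          using U' t' by (auto simp: integral_bridge_def)
        show "partition_of (n t l) (p t l) 0 t" for l
          by (rule part[OF t'])
        have "(\<lambda>x. indicator {0..t} x * k t x) = (\<lambda>x. indicator {0..t} x * k' t x)"
          using k[OF t'] by (auto simp: indicator_def fun_eq_iff)
        then show "L2_tendsto lborel (\<lambda>l. step_fun (n t l) (p t l) (c t l)) (\<lambda>x. indicator {0..t} x * k' t x)"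
          using approx[OF t'] by (simp add: wiener_approximates_def[OF W])
      qed
      then show ?thesis using True by (simp add: S'_def)
    next
      case False
      then have "t = T" using t J by auto
      then have "(\<integral>\<^sup>+\<omega>. ennreal ((U' t \<omega>)\<^sup>2) \<partial>M') = 0"
        using U' by (intro nn_integral_zero') (auto simp: integral_bridge_def)
      then show ?thesis using False by (simp add: S'_def L2_tendsto_def)
    qed
  next
    fix l
    \<comment> \<open>At stage l the elementary integrals for all times in \<open>J\<close> involve
      the driving process only at the finitely many partition points in \<open>?Q\<close>. Their
      joint law is thus the image of a finite-dimensional distribution of the process under the
      fixed map \<open>?F\<close>.\<close>
    let ?Q = "\<Union>t\<in>J \<inter> {0..<T}. p t l ` {..n t l}"
    let ?F = "\<lambda>y. \<lambda>t\<in>J. if t < T then \<Sum>i<n t l. c t l i * (y (p t l (Suc i)) - y (p t l i)) else (0::real)"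
    have Q: "finite ?Q" "?Q \<subseteq> {0..}"
      using J partition_of_bounds(1)[OF part] by auto
    have inQ: "p t l i \<in> ?Q" if "t \<in> J" "t < T" "i \<le> n t l" for t i
      using that J by force
    have F: "?F \<in> PiM ?Q (\<lambda>_. borel) \<rightarrow>\<^sub>M PiM J (\<lambda>_. borel)"
    proof (rule measurable_restrict)
      fix t assume t: "t \<in> J"
      show "(\<lambda>y. if t < T then \<Sum>i<n t l. c t l i * (y (p t l (Suc i)) - y (p t l i)) else (0::real))
          \<in> borel_measurable (PiM ?Q (\<lambda>_. borel))"
      proof (cases "t < T")
        case True
        have [measurable]: "(\<lambda>y. y (p t l i)) \<in> borel_measurable (PiM ?Q (\<lambda>_. borel :: real measure))"
          if "i \<le> n t l" for i
          by (rule measurable_component_singleton[OF inQ[OF t True that]])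
        have "(\<lambda>y. \<Sum>i<n t l. c t l i * (y (p t l (Suc i)) - y (p t l i))) \<in> borel_measurable (PiM ?Q (\<lambda>_. borel))"
          by (intro borel_measurable_sum borel_measurable_times borel_measurable_diff borel_measurable_const) auto
        then show ?thesis using True by simp
      qed simp
    qed
    have *: "distr N (PiM J (\<lambda>_. borel))
          (\<lambda>\<omega>. \<lambda>t\<in>J. (if t < T then step_wiener_integral C (n t l) (p t l) (c t l) else (\<lambda>_. 0)) \<omega>) =
        distr (distr N (PiM ?Q (\<lambda>_. borel)) (\<lambda>\<omega>. \<lambda>s\<in>?Q. C s \<omega>)) (PiM J (\<lambda>_. borel)) ?F"
      if C: "wiener_process N C" for N :: "'x measure" and C
    proof -
      have D: "(\<lambda>\<omega>. \<lambda>s\<in>?Q. C s \<omega>) \<in> N \<rightarrow>\<^sub>M PiM ?Q (\<lambda>_. borel)"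
        using Q by (intro measurable_restrict wiener_measurable[OF C]) auto
      have "(\<lambda>\<omega>. \<lambda>t\<in>J. (if t < T then step_wiener_integral C (n t l) (p t l) (c t l) else (\<lambda>_. 0)) \<omega>) =
          ?F \<circ> (\<lambda>\<omega>. \<lambda>s\<in>?Q. C s \<omega>)"
      proof (intro ext)
        fix \<omega> t
        show "(\<lambda>t\<in>J. (if t < T then step_wiener_integral C (n t l) (p t l) (c t l) else (\<lambda>_. 0)) \<omega>) t =
            (?F \<circ> (\<lambda>\<omega>. \<lambda>s\<in>?Q. C s \<omega>)) \<omega> t"
        proof (cases "t \<in> J \<and> t < T")
          case True
          have "step_wiener_integral C (n t l) (p t l) (c t l) \<omega> =
              (\<Sum>i<n t l. c t l i * ((\<lambda>s\<in>?Q. C s \<omega>) (p t l (Suc i)) - (\<lambda>s\<in>?Q. C s \<omega>) (p t l i)))"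
            unfolding step_wiener_integral_def
          proof (intro sum.cong refl)
            fix i assume "i \<in> {..<n t l}"
            then have "p t l i \<in> ?Q" "p t l (Suc i) \<in> ?Q"
              using True by (intro inQ; simp)+
            then show "c t l i * (C (p t l (Suc i)) \<omega> - C (p t l i) \<omega>) =
                c t l i * ((\<lambda>s\<in>?Q. C s \<omega>) (p t l (Suc i)) - (\<lambda>s\<in>?Q. C s \<omega>) (p t l i))"
              by (simp only: restrict_apply if_True)
          qed
          then show ?thesis using True by (simp del: restrict_apply UN_iff) (simp only: restrict_apply if_True)
        qed auto
      qed
      then show ?thesis by (simp only: distr_distr[OF F D])
    qed
    show "distr M (PiM J (\<lambda>_. borel)) (\<lambda>\<omega>. \<lambda>t\<in>J. S l t \<omega>) = distr M' (PiM J (\<lambda>_. borel)) (\<lambda>\<omega>. \<lambda>t\<in>J. S' l t \<omega>)"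
      unfolding S_def S'_def *[OF W] *[OF W'] wiener_fdd_eq[OF W W' Q] ..
  qed (use J in auto)
qed

section \<open>Laws on the path space, their finite-dimensional marginals and second moments\<close>

lemma distr_process_law_restrict:
  assumes X: "\<And>t. t \<in> {0..T} \<Longrightarrow> X t \<in> borel_measurable M" and J: "J \<subseteq> {0..T}"
  shows "distr (process_law T M X) (PiM J (\<lambda>_. borel)) (\<lambda>x. restrict x J) =
    distr M (PiM J (\<lambda>_. borel)) (\<lambda>\<omega>. \<lambda>t\<in>J. X t \<omega>)"
proof -
  have "distr (process_law T M X) (PiM J (\<lambda>_. borel)) (\<lambda>x. restrict x J) =
      distr M (PiM J (\<lambda>_. borel)) ((\<lambda>x. restrict x J) \<circ> (\<lambda>\<omega>. \<lambda>t\<in>{0..T}. X t \<omega>))"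
    unfolding process_law_def using X J
    by (intro distr_distr measurable_restrict_subset measurable_restrict)
  also have "(\<lambda>x. restrict x J) \<circ> (\<lambda>\<omega>. \<lambda>t\<in>{0..T}. X t \<omega>) = (\<lambda>\<omega>. \<lambda>t\<in>J. X t \<omega>)"
    using J by (auto simp: fun_eq_iff restrict_def)
  finally show ?thesis .
qed

text \<open>The cylinder is the preimage of the box under restriction of paths to \<open>J\<close>,
  and the image law under this restriction is the marginal.\<close>

lemma emeasure_process_law_prod_emb:
  assumes X: "\<And>t. t \<in> {0..T} \<Longrightarrow> X t \<in> borel_measurable M" and J: "finite J" "J \<subseteq> {0..T}"
    and A: "\<And>t. t \<in> J \<Longrightarrow> A t \<in> sets borel"
  shows "emeasure (process_law T M X) (prod_emb {0..T} (\<lambda>_. borel) J (Pi\<^sub>E J A)) =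
    emeasure (distr M (PiM J (\<lambda>_. borel)) (\<lambda>\<omega>. \<lambda>t\<in>J. X t \<omega>)) (Pi\<^sub>E J A)"
proof -
  have restr: "distr (process_law T M X) (PiM J (\<lambda>_. borel)) (\<lambda>x. restrict x J) =
      distr M (PiM J (\<lambda>_. borel)) (\<lambda>\<omega>. \<lambda>t\<in>J. X t \<omega>)"
    using X J(2) by (rule distr_process_law_restrict)
  have "(\<lambda>x. restrict x J) \<in> process_law T M X \<rightarrow>\<^sub>M PiM J (\<lambda>_. borel)"
    using measurable_restrict_subset[OF J(2)] by (simp add: process_law_def)
  moreover have "Pi\<^sub>E J A \<in> sets (PiM J (\<lambda>_. borel))"
    using J A by (intro sets_PiM_I_finite) auto
  ultimately have "emeasure (distr (process_law T M X) (PiM J (\<lambda>_. borel)) (\<lambda>x. restrict x J)) (Pi\<^sub>E J A) =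
      emeasure (process_law T M X) ((\<lambda>x. restrict x J) -` (Pi\<^sub>E J A) \<inter> space (process_law T M X))"
    by (rule emeasure_distr)
  also have "(\<lambda>x. restrict x J) -` (Pi\<^sub>E J A) \<inter> space (process_law T M X) =
      prod_emb {0..T} (\<lambda>_. borel) J (Pi\<^sub>E J A)"
    by (auto simp: prod_emb_def process_law_def space_PiM)
  finally show ?thesis
    unfolding restr by (rule sym)
qed

text \<open>Marginals are images of the law under restriction of paths. Conversely, cylinders over
  finite boxes are stable under intersection and generate the product \<sigma>-algebra, so they
  determine a finite measure.\<close>

lemma process_law_eq_iff:
  assumes M: "prob_space M"
    and X: "\<And>t. t \<in> {0..T} \<Longrightarrow> X t \<in> borel_measurable M"
    and Y: "\<And>t. t \<in> {0..T} \<Longrightarrow> Y t \<in> borel_measurable N"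
  shows "process_law T M X = process_law T N Y \<longleftrightarrow> same_fdd T M X N Y"
proof
  assume law: "process_law T M X = process_law T N Y"
  show "same_fdd T M X N Y"
    unfolding same_fdd_def
  proof (intro allI impI)
    fix J assume J: "finite J \<and> J \<subseteq> {0..T}"
    show "distr M (PiM J (\<lambda>_. borel)) (\<lambda>\<omega>. \<lambda>t\<in>J. X t \<omega>) = distr N (PiM J (\<lambda>_. borel)) (\<lambda>\<omega>. \<lambda>t\<in>J. Y t \<omega>)"
    proof (rule trans[OF sym])
      show "distr (process_law T N Y) (PiM J (\<lambda>_. borel)) (\<lambda>x. restrict x J) =
          distr M (PiM J (\<lambda>_. borel)) (\<lambda>\<omega>. \<lambda>t\<in>J. X t \<omega>)"
        unfolding law[symmetric] using X J by (intro distr_process_law_restrict) auto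
      show "distr (process_law T N Y) (PiM J (\<lambda>_. borel)) (\<lambda>x. restrict x J) =
          distr N (PiM J (\<lambda>_. borel)) (\<lambda>\<omega>. \<lambda>t\<in>J. Y t \<omega>)"
        using Y J by (intro distr_process_law_restrict) auto
    qed
  qed
next
  assume fdd: "same_fdd T M X N Y"
  interpret M: prob_space M by fact
  show "process_law T M X = process_law T N Y"
  proof (rule measure_eqI_PiM_infinite)
    show "finite_measure (process_law T M X)"
      unfolding process_law_def using X by (intro M.finite_measure_distr measurable_restrict)
    fix A :: "real \<Rightarrow> real set" and J
    assume J: "finite J" "J \<subseteq> {0..T}" and A: "\<And>i. i \<in> J \<Longrightarrow> A i \<in> sets borel"
    have "emeasure (process_law T M X) (prod_emb {0..T} (\<lambda>_. borel) J (Pi\<^sub>E J A)) =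
        emeasure (distr M (PiM J (\<lambda>_. borel)) (\<lambda>\<omega>. \<lambda>t\<in>J. X t \<omega>)) (Pi\<^sub>E J A)"
      using X J A by (rule emeasure_process_law_prod_emb)
    also have "distr M (PiM J (\<lambda>_. borel)) (\<lambda>\<omega>. \<lambda>t\<in>J. X t \<omega>) = distr N (PiM J (\<lambda>_. borel)) (\<lambda>\<omega>. \<lambda>t\<in>J. Y t \<omega>)"
      using J by (intro fdd[unfolded same_fdd_def, rule_format] conjI)
    also have "emeasure \<dots> (Pi\<^sub>E J A) = emeasure (process_law T N Y) (prod_emb {0..T} (\<lambda>_. borel) J (Pi\<^sub>E J A))"
      using Y J A by (rule emeasure_process_law_prod_emb[symmetric])
    finally show "emeasure (process_law T M X) (prod_emb {0..T} (\<lambda>_. borel) J (Pi\<^sub>E J A)) =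
        emeasure (process_law T N Y) (prod_emb {0..T} (\<lambda>_. borel) J (Pi\<^sub>E J A))" .
  qed (simp_all add: process_law_def)
qed

lemma same_fdd_sym: "same_fdd T M X N Y \<Longrightarrow> same_fdd T N Y M X"
  by (simp add: same_fdd_def)

lemma same_fdd_trans: "same_fdd T M X N Y \<Longrightarrow> same_fdd T N Y L Z \<Longrightarrow> same_fdd T M X L Z"
  by (simp add: same_fdd_def)

lemma integral_distr_mult:
  assumes "X s \<in> borel_measurable M" "X t \<in> borel_measurable M"
  shows "(\<integral>y. y s * y t \<partial>distr M (PiM {s, t} (\<lambda>_. borel)) (\<lambda>\<omega>. \<lambda>u\<in>{s, t}. X u \<omega>)) =
    (\<integral>\<omega>. X s \<omega> * X t \<omega> \<partial>M :: real)"
proof -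
  have X: "(\<lambda>\<omega>. \<lambda>u\<in>{s, t}. X u \<omega>) \<in> M \<rightarrow>\<^sub>M PiM {s, t} (\<lambda>_. borel)"
    using assms by (intro measurable_restrict) auto
  have "(\<lambda>y. y s * y t) \<in> borel_measurable (PiM {s, t} (\<lambda>_. borel :: real measure))"
    by (intro borel_measurable_times measurable_component_singleton) auto
  from integral_distr[OF X this] show ?thesis by simp
qed

text \<open>The product moment is an integral against the marginal on {s, t}, which is a single
  point if s = t.\<close>

lemma same_fdd_expectation_mult:
  assumes "same_fdd T M X N Y" "s \<in> {0..T}" "t \<in> {0..T}"
    and "X s \<in> borel_measurable M" "X t \<in> borel_measurable M"
    and "Y s \<in> borel_measurable N" "Y t \<in> borel_measurable N"
  shows "(\<integral>\<omega>. X s \<omega> * X t \<omega> \<partial>M) = (\<integral>\<omega>. Y s \<omega> * Y t \<omega> \<partial>N)"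
proof -
  have "distr M (PiM {s, t} (\<lambda>_. borel)) (\<lambda>\<omega>. \<lambda>u\<in>{s, t}. X u \<omega>) =
      distr N (PiM {s, t} (\<lambda>_. borel)) (\<lambda>\<omega>. \<lambda>u\<in>{s, t}. Y u \<omega>)"
    using assms(2,3) by (intro assms(1)[unfolded same_fdd_def, rule_format]) auto
  then show ?thesis
    using integral_distr_mult[OF assms(4,5)] integral_distr_mult[OF assms(6,7)] by simp
qed

theorem theorem4p5:
  fixes T :: real and q \<sigma> :: "real \<Rightarrow> real"
    and M :: "'a measure" and B Z :: "real \<Rightarrow> 'a \<Rightarrow> real"
    and N :: "'b measure" and U :: "real \<Rightarrow> 'b \<Rightarrow> real"
    and M' :: "'c measure" and B' :: "real \<Rightarrow> 'c \<Rightarrow> real"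
    and N' :: "'d measure" and X :: "real \<Rightarrow> 'd \<Rightarrow> real"
  assumes "T > 0"
    and "continuous_on {0..} q"
    and "continuous_on {0..} \<sigma>"
    and "\<forall>t\<ge>0. \<sigma> t \<noteq> 0"
    and "\<exists>q'. (\<forall>t\<in>{0..<T}. (q has_real_derivative q' t) (at t within {0..<T})) \<and>
              continuous_on {0..<T} q'"
    and "ou_type_process M B q \<sigma> Z"
    and "ou_bridge M B q \<sigma> T N U"
    and "wiener_process M' B'"
    and "wiener_bridge M' B' T N' X"
  shows "process_law T N U = process_law T N' X \<longleftrightarrow>
    ((\<exists>C::real. C \<notin> {-T..0} \<and> (\<forall>t\<in>{0..<T}. q t = 1 / (t + C))) \<or> (\<forall>t\<in>{0..<T}. q t = 0)) \<and>
    ((\<forall>t\<in>{0..<T}. \<sigma> t = 1) \<or> (\<forall>t\<in>{0..<T}. \<sigma> t = -1))" (is "?law \<longleftrightarrow> ?q \<and> ?\<sigma>")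
proof -
  interpret ou_coefficients T q \<sigma>
    using assms by unfold_locales (auto intro: continuous_on_subset)
  have W: "wiener_process M B" and W': "wiener_process M' B'"
    using assms by (auto simp: ou_type_process_def)
  \<comment> \<open>\<open>U\<close> and \<open>X\<close> may live on spaces without a driving
    process. Covariances and approximations are available for the integral processes
    \<open>V\<close> and \<open>V'\<close>, which have the same finite-dimensional
    distributions.\<close>
  obtain V where V: "integral_bridge M B bridge_kernel T V" and UV: "same_fdd T N U M V"
    using assms(7) unfolding ou_bridge_def bridge_kernel_def[abs_def, symmetric] by (elim conjE exE)
  obtain V' where V': "integral_bridge M' B' (\<lambda>t s. (T - t) / (T - s)) T V'" and XV': "same_fdd T N' X M' V'"
    using assms(9) unfolding wiener_bridge_def by (elim conjE exE)
  have meas: "V t \<in> borel_measurable M" "V' t \<in> borel_measurable M'" if "t \<in> {0..T}" for t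
    using V V' that by (auto simp: integral_bridge_def ae_continuous_process_def)
  have "?law \<longleftrightarrow> same_fdd T N U N' X"
    using assms by (intro process_law_eq_iff)
      (auto simp: ou_bridge_def wiener_bridge_def ae_continuous_process_def)
  also have "\<dots> \<longleftrightarrow> same_fdd T M V M' V'"
    using same_fdd_trans[OF same_fdd_sym[OF UV] same_fdd_trans[OF _ XV']]
      same_fdd_trans[OF UV same_fdd_trans[OF _ same_fdd_sym[OF XV']]] by blast
  also have "\<dots> \<longleftrightarrow> ?q \<and> ?\<sigma>"
  proof
    assume fdd: "same_fdd T M V M' V'"
    have cov: "G t * E t * (E s * (1 - G s / G 0)) = (T - t) * s / T" if st: "0 \<le> s" "s \<le> t" "t < T" for s t
    proof -
      have I: "has_wiener_integral M B (bridge_kernel s) 0 s (V s)" "has_wiener_integral M B (bridge_kernel t) 0 t (V t)"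
        and I': "has_wiener_integral M' B' (\<lambda>x. (T - s) / (T - x)) 0 s (V' s)"
          "has_wiener_integral M' B' (\<lambda>x. (T - t) / (T - x)) 0 t (V' t)"
        using V V' st by (auto simp: integral_bridge_def)
      have "(\<integral>\<omega>. V s \<omega> * V t \<omega> \<partial>M) = (\<integral>\<omega>. V' s \<omega> * V' t \<omega> \<partial>M')"
        using st by (intro same_fdd_expectation_mult[OF fdd] meas) auto
      then show ?thesis
        unfolding has_wiener_integral_covariance[OF W I] has_wiener_integral_covariance[OF W' I']
          kernel_covariance[OF st] wiener_kernel_covariance[OF st] .
    qed
    obtain \<kappa> where \<kappa>: "0 < 1 + \<kappa> * T" and q_eq: "\<And>t. t \<in> {0..<T} \<Longrightarrow> q t = \<kappa> / (1 + \<kappa> * t)"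
      and \<sigma>_eq: "\<And>t. t \<in> {0..<T} \<Longrightarrow> (\<sigma> t)\<^sup>2 = 1"
      using coefficients_of_covariance[OF cov] by blast
    have ?q
    proof (cases "\<kappa> = 0")
      case False
      \<comment> \<open>Either 1 / \<kappa> is positive, or 1 / \<kappa> + T = (1 + \<kappa> T) /
        \<kappa> is negative.\<close>
      have "1 / \<kappa> \<notin> {-T..0}"
      proof (cases "0 < \<kappa>")
        case neg: False
        then have "(1 + \<kappa> * T) / \<kappa> < 0"
          using False \<kappa> by (intro divide_pos_neg) auto
        then show ?thesis using False by (simp add: add_divide_distrib)
      qed simp
      moreover have "q t = 1 / (t + 1 / \<kappa>)" if "t \<in> {0..<T}" for t
        using q_eq[OF that] False by (simp add: field_simps)
      ultimately show ?thesis by blast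
    qed (use q_eq in auto)
    then show "?q \<and> ?\<sigma>"
      using \<sigma>_constant_sign[OF \<sigma>_eq] by blast
  next
    assume R: "?q \<and> ?\<sigma>"
    then have \<sigma>_eq: "\<And>t. t \<in> {0..<T} \<Longrightarrow> (\<sigma> t)\<^sup>2 = 1" by auto
    obtain \<kappa> where \<kappa>: "0 < 1 + \<kappa> * T" and q_eq: "\<And>t. t \<in> {0..<T} \<Longrightarrow> q t = \<kappa> / (1 + \<kappa> * t)"
    proof -
      from R consider C where "C \<notin> {-T..0}" "\<forall>t\<in>{0..<T}. q t = 1 / (t + C)" | "\<forall>t\<in>{0..<T}. q t = 0"
        by blast
      then show ?thesis
      proof cases
        case 1
        have "C \<noteq> 0" using 1(1) T by auto
        show ?thesis
        proof (rule that[of "1 / C"])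
          \<comment> \<open>For C > 0 all terms are positive; for C < -T the quotient T / C exceeds
            -1.\<close>
          show "0 < 1 + 1 / C * T"
            using 1(1) T by (cases "0 < C") (auto simp: field_simps)
          show "q t = 1 / C / (1 + 1 / C * t)" if "t \<in> {0..<T}" for t
            using 1 that \<open>C \<noteq> 0\<close> by (simp add: field_simps)
        qed
      next
        case 2
        then show ?thesis by (intro that[of 0]) auto
      qed
    qed
    note kernel = kernel_of_coefficients[OF \<kappa> q_eq \<sigma>_eq]
    from R consider "\<forall>t\<in>{0..<T}. \<sigma> t = 1" | "\<forall>t\<in>{0..<T}. \<sigma> t = -1" by blast
    then show "same_fdd T M V M' V'"
    proof cases
      case 1
      then show ?thesis
        by (intro integral_bridge_same_fdd[OF W W' V V'], subst kernel) auto
    next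
      case 2
      \<comment> \<open>The sign is absorbed into the driving process: \<open>-B\<close> is a Wiener process, too.\<close>
      then show ?thesis
        by (intro integral_bridge_same_fdd[OF wiener_process_uminus[OF W] W' integral_bridge_uminus[OF V] V'], subst kernel)
          auto
    qed
  qed
  finally show ?thesis .
qed

end
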